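(* The set of $n$-symmetric ovals that have at least one family of elliptic symmetric orbits and one family of hyperbolic symmetric orbits is open and dense in $\mathcal{N}$ with the topology induced by $\mathcal{G}$.
   Context: Fix an integer $n\ge 2$. An oval is a regular, closed, $C^\infty$ plane curve with strictly positive curvature, parametrized by the angle $\phi\in\mathbb{R}/2\pi\mathbb{Z}$ between its tangent vector $\sigma(\phi)=(\cos\phi,\sin\phi)$ and the positive horizontal axis. It is $n$-symmetric if it is invariant under the rotation by $\frac{2\pi}{n}$ around a point (the symmetry center), taken to be the origin. $\mathcal{N}$ denotes the set of $C^\infty$ $n$-symmetric ovals with symmetry center at the origin. With $\eta(\phi)=(-\sin\phi,\cos\phi)$ the inward normal, the support function of $\Gamma$ is $g(\phi)=-\langle\Gamma(\phi),\eta(\phi)\rangle$, and $R=g+g''$ is the radius of curvature. With $S_n=\mathbb{R}/\frac{2\pi}{n}\mathbb{Z}$, the map $\Gamma\mapsto g$ is a bijection from $\mathcal{N}$ onto $\mathcal{G}=\{g\in C^\infty(S_n,\mathbb{R}): g>0,\ g+g''>0\}$. $\mathcal{G}$ carries the topology of the $C^2$ norm $\|\cdot\|_2$, and $\mathcal{N}$ the topology making this bijection a homeomorphism. Billiard map: a particle moves at constant speed along straight segments inside the region bounded by $\Gamma$ and reflects elastically at $\Gamma$. A collision is described by $(\phi,p)$, where $\Gamma(\phi)$ is the impact point and $p=\cos\alpha$ with $\alpha\in(0,\pi)$ the outgoing angle measured from $\sigma(\phi)$. The billiard map $T$ on $\Omega=\mathbb{R}/2\pi\mathbb{Z}\times(-1,1)$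 sends each collision to the next. Let $\phi_0\in S_n$ be a critical point of $g$. The family of ($n$-)symmetric orbits associated to $\phi_0$ is the set of $T$-orbits of the points $(\phi_k,p_m)$, $m=1,\dots,n-1$, $k=0,\dots,\gcd(n,m)-1$, where $\phi_k=\phi_0+\frac{2k\pi}{n}$ and $p_m=\cos\frac{m\pi}{n}$; these orbits are periodic of period $n/\gcd(n,m)$. For $1\le m\le n-1$, $T$ commutes with $\phi\mapsto\phi+\frac{2m\pi}{n}$ and so induces the $m$-quotient map $T_m$ on the quotient of $\Omega$ by the equivalence relation generated by $(\phi,p)\sim_m(\phi+\frac{2m\pi}{n},p)$. Each $(\phi_k,p_m)$ is a fixed point of $T_m$. By convention, the orbit of $(\phi_k,p_m)$ is called elliptic (hyperbolic) if this fixed point of $T_m$ is elliptic, i.e. $DT_m$ there has non-real eigenvalues of modulus 1 (hyperbolic, i.e. $DT_m$ there has real eigenvalues of modulus $\neq1$). A family is elliptic (hyperbolic) if all its orbits are. *)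

theory Defs
  imports "HOL-Analysis.Analysis" "Jordan_Normal_Form.Char_Poly"
begin

text \<open>The plane is the type \<^typ>\<open>complex\<close>, with inner product \<^const>\<open>inner\<close>; the rotation by
  \<open>\<theta>\<close> about the origin is multiplication by \<open>cis \<theta>\<close>.  Functions on \<open>\<real>/P\<int>\<close> that have to be
  differentiated are \<open>P\<close>-periodic functions on \<open>\<real>\<close>.\<close>

definition nderiv :: "nat \<Rightarrow> (real \<Rightarrow> 'a::real_normed_vector) \<Rightarrow> real \<Rightarrow> 'a" where
  "nderiv k f = ((\<lambda>h x. vector_derivative h (at x)) ^^ k) f"

definition C_infinity :: "(real \<Rightarrow> 'a::real_normed_vector) \<Rightarrow> bool" where
  "C_infinity f \<longleftrightarrow> (\<forall>k x. nderiv k f differentiable at x)"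

definition periodic :: "real \<Rightarrow> (real \<Rightarrow> 'a) \<Rightarrow> bool" where
  "periodic P f \<longleftrightarrow> (\<forall>x. f (x + P) = f x)"


section \<open>Symmetric ovals, support functions and the topology\<close>

definition tangent :: "real \<Rightarrow> complex" where
  "tangent \<phi> = cis \<phi>"

definition normal :: "real \<Rightarrow> complex" where
  "normal \<phi> = \<i> * cis \<phi>"

text \<open>The parameter \<open>\<phi>\<close> is the tangent angle: the velocity is \<open>R(\<phi>)\<close> times \<open>tangent \<phi>\<close>, where
  \<open>R(\<phi>) = ds/d\<phi>\<close> is the radius of curvature, so \<open>R > 0\<close> expresses regularity and positive
  curvature.  As \<open>\<phi>\<close> ranges over \<open>\<real>/2\<pi>\<int>\<close>, the tangent turns exactly once.\<close>

definition oval :: "(real \<Rightarrow> complex) \<Rightarrow> bool" where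
  "oval \<Gamma> \<longleftrightarrow> C_infinity \<Gamma> \<and> periodic (2 * pi) \<Gamma> \<and>
     (\<forall>\<phi>. \<exists>R>0. (\<Gamma> has_vector_derivative R *\<^sub>R tangent \<phi>) (at \<phi>))"

definition sym_ovals :: "nat \<Rightarrow> (real \<Rightarrow> complex) set" where
  "sym_ovals n = {\<Gamma>. oval \<Gamma> \<and> (\<lambda>z. cis (2 * pi / real n) * z) ` range \<Gamma> = range \<Gamma>}"

definition support_fun :: "(real \<Rightarrow> complex) \<Rightarrow> real \<Rightarrow> real" where
  "support_fun \<Gamma> \<phi> = - inner (\<Gamma> \<phi>) (normal \<phi>)"

definition support_space :: "nat \<Rightarrow> (real \<Rightarrow> real) set" where
  "support_space n = {g. C_infinity g \<and> periodic (2 * pi / real n) g \<and>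
     (\<forall>\<phi>. g \<phi> > 0) \<and> (\<forall>\<phi>. g \<phi> + nderiv 2 g \<phi> > 0)}"

definition C2_norm :: "(real \<Rightarrow> real) \<Rightarrow> real" where
  "C2_norm f = (MAX k\<in>{..2}. SUP x. \<bar>nderiv k f x\<bar>)"

text \<open>The value \<open>0\<close> off the space is irrelevant for the topology; it only serves the locale
  \<^locale>\<open>Metric_space\<close>, whose axioms of nonnegativity and symmetry range over the whole type.\<close>

definition C2_dist :: "nat \<Rightarrow> (real \<Rightarrow> real) \<Rightarrow> (real \<Rightarrow> real) \<Rightarrow> real" where
  "C2_dist n f g =
     (if f \<in> support_space n \<and> g \<in> support_space n then C2_norm (\<lambda>x. f x - g x) else 0)"

lemma C2_parts:
  assumes "f \<in> support_space n" "g \<in> support_space n" "n > 0" "k \<le> 2"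
  shows "nderiv k (\<lambda>x. f x - g x) = (\<lambda>x. nderiv k f x - nderiv k g x)"
    and "bounded (range (nderiv k f))"
proof -
  have suc: "nderiv (Suc k) h = (\<lambda>x. vector_derivative (nderiv k h) (at x))" for k and h :: "real \<Rightarrow> real"
    by (simp add: nderiv_def)
  have smooth: "nderiv k h differentiable at x" if "h \<in> support_space n" for k h x
    using that by (simp add: support_space_def C_infinity_def)
  show "nderiv k (\<lambda>x. f x - g x) = (\<lambda>x. nderiv k f x - nderiv k g x)"
  proof (induction k)
    case 0
    then show ?case by (simp add: nderiv_def)
  next
    case (Suc k)
    then show ?case
      using smooth assms by (simp add: suc vector_derivative_diff_at)
  qed
  define P where "P = 2 * pi / real n"
  have P: "P > 0" using assms by (simp add: P_def)
  have per: "nderiv k f (x + P) = nderiv k f x" for k x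
  proof (induction k arbitrary: x)
    case 0
    then show ?case using assms by (simp add: nderiv_def support_space_def periodic_def P_def)
  next
    case (Suc k)
    have "(nderiv k f has_vector_derivative vector_derivative (nderiv k f) (at (x + P))) (at (x + P))"
      using smooth assms vector_derivative_works by blast
    then have "((\<lambda>y. nderiv k f (y + P)) has_vector_derivative
        vector_derivative (nderiv k f) (at (x + P))) (at x)"
      using vector_diff_chain_at[of "\<lambda>y. y + P" 1 x "nderiv k f"]
        has_vector_derivative_add_const[of "\<lambda>y. y" P 1 "at x"]
      by (simp add: o_def has_vector_derivative_id[unfolded id_def])
    then show ?case
      by (simp add: suc Suc vector_derivative_at)
  qed
  have perm: "nderiv k f (x + real j * P) = nderiv k f x" for j x
  proof (induction j)
    case (Suc j)
    then show ?case using per[of k "x + real j * P"] by (simp add: algebra_simps)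
  qed simp
  have "range (nderiv k f) \<subseteq> nderiv k f ` {0..P}"
  proof clarify
    fix x
    define j where "j = \<lfloor>x / P\<rfloor>"
    define y where "y = x - of_int j * P"
    have "of_int j \<le> x / P" "x / P < of_int j + 1" by (auto simp: j_def)
    then have y: "y \<in> {0..P}" using P by (auto simp: y_def field_simps)
    have "nderiv k f x = nderiv k f y"
    proof (cases "j \<ge> 0")
      case True
      then show ?thesis using perm[of y "nat j"] by (simp add: y_def)
    next
      case False
      then show ?thesis using perm[of x "nat (- j)"] by (simp add: y_def)
    qed
    then show "nderiv k f x \<in> nderiv k f ` {0..P}" using y by blast
  qed
  moreover have "compact (nderiv k f ` {0..P})"
    by (intro compact_continuous_image continuous_at_imp_continuous_on ballI
        differentiable_imp_continuous_within smooth assms compact_Icc)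
  ultimately show "bounded (range (nderiv k f))"
    using bounded_subset compact_imp_bounded by blast
qed

lemma Metric_space_C2_dist:
  assumes "n > 0"
  shows "Metric_space (support_space n) (C2_dist n)"
proof -
  define s where "s k f g = (SUP x. \<bar>nderiv k f x - nderiv k g x\<bar>)" for k and f g :: "real \<Rightarrow> real"
  have dist: "C2_dist n f g = (MAX k\<in>{..2}. s k f g)"
    if "f \<in> support_space n" "g \<in> support_space n" for f g
    using C2_parts(1)[OF that assms] that by (simp add: C2_dist_def C2_norm_def s_def)
  have s_upper: "\<bar>nderiv k f x - nderiv k g x\<bar> \<le> s k f g"
    if "f \<in> support_space n" "g \<in> support_space n" "k \<le> 2" for f g k x
  proof -
    have "bounded (range (\<lambda>x. nderiv k f x - nderiv k g x))"
      using C2_parts(2)[OF that(1,1) assms that(3)] C2_parts(2)[OF that(2,2) assms that(3)]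
      by (rule bounded_minus_comp)
    then obtain c where "\<And>x. \<bar>nderiv k f x - nderiv k g x\<bar> \<le> c"
      by (auto simp: bounded_iff)
    then show ?thesis unfolding s_def
      by (intro cSUP_upper bdd_aboveI2) auto
  qed
  have s_le: "s k f g \<le> C2_dist n f g"
    if "f \<in> support_space n" "g \<in> support_space n" "k \<le> 2" for f g k
    using that by (simp add: dist)
  have dist_le: "C2_dist n f g \<le> c"
    if "f \<in> support_space n" "g \<in> support_space n"
      "\<And>k x. k \<le> 2 \<Longrightarrow> \<bar>nderiv k f x - nderiv k g x\<bar> \<le> c" for f g c
    using that by (auto simp: dist s_def intro!: cSUP_least)
  have nn: "0 \<le> C2_dist n f g" for f g
  proof (cases "f \<in> support_space n \<and> g \<in> support_space n")
    case True
    then show ?thesis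
      using s_upper[of f g 0 0] s_le[of f g 0] by fastforce
  qed (auto simp: C2_dist_def)
  show ?thesis
  proof
    fix f g h :: "real \<Rightarrow> real"
    show "0 \<le> C2_dist n f g" by (rule nn)
    show "C2_dist n f g = C2_dist n g f"
    proof (cases "f \<in> support_space n \<and> g \<in> support_space n")
      case True
      then show ?thesis by (simp add: dist s_def abs_minus_commute)
    qed (auto simp: C2_dist_def)
    assume fg: "f \<in> support_space n" "g \<in> support_space n"
    show "C2_dist n f g = 0 \<longleftrightarrow> f = g"
    proof
      assume "C2_dist n f g = 0"
      then have "\<bar>nderiv 0 f x - nderiv 0 g x\<bar> \<le> 0" for x
        using s_upper[OF fg, of 0 x] s_le[OF fg, of 0] by simp
      then show "f = g" by (auto simp: nderiv_def)
    next
      assume "f = g"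
      then have "C2_dist n f g \<le> 0" using fg by (intro dist_le) auto
      then show "C2_dist n f g = 0" using nn[of f g] by simp
    qed
    assume h: "h \<in> support_space n"
    show "C2_dist n f h \<le> C2_dist n f g + C2_dist n g h"
    proof (rule dist_le[OF fg(1) h])
      fix k :: nat and x assume k: "k \<le> 2"
      show "\<bar>nderiv k f x - nderiv k h x\<bar> \<le> C2_dist n f g + C2_dist n g h"
        using s_upper[OF fg k, of x] s_le[OF fg k] s_upper[OF fg(2) h k, of x] s_le[OF fg(2) h k]
        by linarith
    qed
  qed
qed

definition support_topology :: "nat \<Rightarrow> (real \<Rightarrow> real) topology" where
  "support_topology n = Metric_space.mtopology (support_space n) (C2_dist n)"

text \<open>Since \<^const>\<open>support_fun\<close> maps \<open>sym_ovals n\<close> bijectively onto \<open>support_space n\<close>, the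
  pullback topology is the one that makes this bijection a homeomorphism.\<close>

definition oval_topology :: "nat \<Rightarrow> (real \<Rightarrow> complex) topology" where
  "oval_topology n = pullback_topology (sym_ovals n) support_fun (support_topology n)"


section \<open>The billiard map and its quotients\<close>

text \<open>In the phase space the circle \<open>\<real>/2\<pi>\<int>\<close> is the unit circle, the class of \<open>\<phi>\<close> being
  \<open>cis \<phi>\<close>.\<close>

type_synonym phase_pt = "complex \<times> real"

definition phase_space :: "phase_pt set" where
  "phase_space = sphere 0 1 \<times> {-1<..<1}"

definition phase :: "real \<times> real \<Rightarrow> phase_pt" where
  "phase = (\<lambda>(\<phi>, p). (cis \<phi>, p))"

definition direction :: "real \<Rightarrow> real \<Rightarrow> complex" where
  "direction \<phi> \<alpha> = cos \<alpha> *\<^sub>R tangent \<phi> + sin \<alpha> *\<^sub>R normal \<phi>"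

text \<open>The particle leaves \<open>\<Gamma> \<phi>\<close> in direction \<open>d\<close>, next hits \<open>\<Gamma>\<close> at \<open>\<Gamma> \<psi>\<close> and leaves
  again in the direction obtained from \<open>d\<close> by reversing its normal component.  Because an oval is
  strictly convex, the ray from \<open>\<Gamma> \<phi>\<close> meets it in exactly one further point.\<close>

definition next_collision :: "(real \<Rightarrow> complex) \<Rightarrow> phase_pt \<Rightarrow> phase_pt \<Rightarrow> bool" where
  "next_collision \<Gamma> x y \<longleftrightarrow>
     (\<exists>\<phi> \<alpha> \<psi> \<beta> t. x = phase (\<phi>, cos \<alpha>) \<and> \<alpha> \<in> {0<..<pi} \<and>
        y = phase (\<psi>, cos \<beta>) \<and> \<beta> \<in> {0<..<pi} \<and>
        t > 0 \<and> \<Gamma> \<psi> = \<Gamma> \<phi> + t *\<^sub>R direction \<phi> \<alpha> \<and>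
        (let d = direction \<phi> \<alpha>
         in direction \<psi> \<beta> = d - (2 * inner d (normal \<psi>)) *\<^sub>R normal \<psi>))"

definition billiard_map :: "(real \<Rightarrow> complex) \<Rightarrow> phase_pt \<Rightarrow> phase_pt" where
  "billiard_map \<Gamma> x = (THE y. next_collision \<Gamma> x y)"

definition phase_rot :: "nat \<Rightarrow> nat \<Rightarrow> phase_pt \<Rightarrow> phase_pt" where
  "phase_rot n m = (\<lambda>(u, p). (cis (2 * real m * pi / real n) * u, p))"

definition quot_rel :: "nat \<Rightarrow> nat \<Rightarrow> (phase_pt \<times> phase_pt) set" where
  "quot_rel n m = {(x, y). x \<in> phase_space \<and> y \<in> phase_space \<and>
     equivclp (\<lambda>a b. b = phase_rot n m a) x y}"

text \<open>\<open>T\<^sub>m\<close> maps the class of \<open>x\<close> to the class of \<open>T x\<close>; points of the quotient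
  \<open>phase_space // quot_rel n m\<close> are classes.\<close>

definition quot_map :: "nat \<Rightarrow> nat \<Rightarrow> (real \<Rightarrow> complex) \<Rightarrow> phase_pt set \<Rightarrow> phase_pt set" where
  "quot_map n m \<Gamma> c = quot_rel n m `` (billiard_map \<Gamma> ` c)"

definition quot_pt :: "nat \<Rightarrow> nat \<Rightarrow> real \<times> real \<Rightarrow> phase_pt set" where
  "quot_pt n m z = quot_rel n m `` {phase z}"

text \<open>The map \<open>quot_pt n m\<close> is a covering of the quotient by the strip \<open>\<real> \<times> (-1, 1)\<close>, so near
  \<open>z\<close> it provides the coordinates \<open>(\<phi>, p)\<close>.  If the class of \<open>z\<close> is fixed by \<open>T\<^sub>m\<close>, then
  \<open>T\<^sub>m\<close> reads in these coordinates as the local lift \<open>F\<close> with \<open>F z = z\<close>.  A lift that is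
  continuous at \<open>z\<close> is unique near \<open>z\<close>, hence so is its derivative \<open>D\<close>.\<close>

definition has_quot_derivative ::
    "nat \<Rightarrow> nat \<Rightarrow> (real \<Rightarrow> complex) \<Rightarrow> real \<times> real \<Rightarrow> (real \<times> real \<Rightarrow> real \<times> real) \<Rightarrow> bool" where
  "has_quot_derivative n m \<Gamma> z D \<longleftrightarrow>
     (\<exists>F. F z = z \<and>
        (\<forall>\<^sub>F w in nhds z. quot_pt n m (F w) = quot_map n m \<Gamma> (quot_pt n m w)) \<and>
        (F has_derivative D) (at z))"

definition jacobian_mat :: "(real \<times> real \<Rightarrow> real \<times> real) \<Rightarrow> complex mat" where
  "jacobian_mat D = map_mat complex_of_real (mat_of_rows_list 2
     [[fst (D (1, 0)), fst (D (0, 1))],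
      [snd (D (1, 0)), snd (D (0, 1))]])"

definition elliptic_fixpoint :: "nat \<Rightarrow> nat \<Rightarrow> (real \<Rightarrow> complex) \<Rightarrow> real \<times> real \<Rightarrow> bool" where
  "elliptic_fixpoint n m \<Gamma> z \<longleftrightarrow>
     (\<exists>D. has_quot_derivative n m \<Gamma> z D \<and>
        (\<forall>\<mu>. eigenvalue (jacobian_mat D) \<mu> \<longrightarrow> \<mu> \<notin> \<real> \<and> cmod \<mu> = 1))"

definition hyperbolic_fixpoint :: "nat \<Rightarrow> nat \<Rightarrow> (real \<Rightarrow> complex) \<Rightarrow> real \<times> real \<Rightarrow> bool" where
  "hyperbolic_fixpoint n m \<Gamma> z \<longleftrightarrow>
     (\<exists>D. has_quot_derivative n m \<Gamma> z D \<and>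
        (\<forall>\<mu>. eigenvalue (jacobian_mat D) \<mu> \<longrightarrow> \<mu> \<in> \<real> \<and> cmod \<mu> \<noteq> 1))"


section \<open>Families of symmetric orbits\<close>

definition support_critical :: "(real \<Rightarrow> complex) \<Rightarrow> real \<Rightarrow> bool" where
  "support_critical \<Gamma> \<phi> \<longleftrightarrow> (support_fun \<Gamma> has_real_derivative 0) (at \<phi>)"

definition sym_indices :: "nat \<Rightarrow> (nat \<times> nat) set" where
  "sym_indices n = {(k, m). 1 \<le> m \<and> m \<le> n - 1 \<and> k < gcd n m}"

definition sym_pt :: "nat \<Rightarrow> real \<Rightarrow> nat \<Rightarrow> nat \<Rightarrow> real \<times> real" where
  "sym_pt n \<phi>\<^sub>0 k m = (\<phi>\<^sub>0 + 2 * real k * pi / real n, cos (real m * pi / real n))"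

text \<open>Forward orbits suffice, since the orbits in question are periodic.\<close>

definition billiard_orbit :: "(real \<Rightarrow> complex) \<Rightarrow> phase_pt \<Rightarrow> phase_pt set" where
  "billiard_orbit \<Gamma> x = range (\<lambda>j. (billiard_map \<Gamma> ^^ j) x)"

definition sym_family :: "nat \<Rightarrow> (real \<Rightarrow> complex) \<Rightarrow> real \<Rightarrow> phase_pt set set" where
  "sym_family n \<Gamma> \<phi>\<^sub>0 = (\<lambda>(k, m). billiard_orbit \<Gamma> (phase (sym_pt n \<phi>\<^sub>0 k m))) ` sym_indices n"

definition sym_families :: "nat \<Rightarrow> (real \<Rightarrow> complex) \<Rightarrow> phase_pt set set set" where
  "sym_families n \<Gamma> = {sym_family n \<Gamma> \<phi>\<^sub>0 |\<phi>\<^sub>0. support_critical \<Gamma> \<phi>\<^sub>0}"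

text \<open>The orbit of \<open>(\<phi>\<^sub>k, p\<^sub>m)\<close> inherits the type of the fixed point \<open>(\<phi>\<^sub>k, p\<^sub>m)\<close> of \<open>T\<^sub>m\<close>.  The
  same orbit may be presented by several \<open>\<phi>\<^sub>0\<close> and \<open>k\<close>; the presenting points differ by
  rotations by multiples of \<open>2\<pi>/n\<close>, which commute with \<open>T\<close>, so all of them have the same type.\<close>

definition elliptic_orbit :: "nat \<Rightarrow> (real \<Rightarrow> complex) \<Rightarrow> phase_pt set \<Rightarrow> bool" where
  "elliptic_orbit n \<Gamma> S \<longleftrightarrow>
     (\<exists>\<phi>\<^sub>0 k m. support_critical \<Gamma> \<phi>\<^sub>0 \<and> (k, m) \<in> sym_indices n \<and>
        S = billiard_orbit \<Gamma> (phase (sym_pt n \<phi>\<^sub>0 k m)) \<and>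
        elliptic_fixpoint n m \<Gamma> (sym_pt n \<phi>\<^sub>0 k m))"

definition hyperbolic_orbit :: "nat \<Rightarrow> (real \<Rightarrow> complex) \<Rightarrow> phase_pt set \<Rightarrow> bool" where
  "hyperbolic_orbit n \<Gamma> S \<longleftrightarrow>
     (\<exists>\<phi>\<^sub>0 k m. support_critical \<Gamma> \<phi>\<^sub>0 \<and> (k, m) \<in> sym_indices n \<and>
        S = billiard_orbit \<Gamma> (phase (sym_pt n \<phi>\<^sub>0 k m)) \<and>
        hyperbolic_fixpoint n m \<Gamma> (sym_pt n \<phi>\<^sub>0 k m))"

definition elliptic_family :: "nat \<Rightarrow> (real \<Rightarrow> complex) \<Rightarrow> phase_pt set set \<Rightarrow> bool" where
  "elliptic_family n \<Gamma> \<F> \<longleftrightarrow> (\<forall>S\<in>\<F>. elliptic_orbit n \<Gamma> S)"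

definition hyperbolic_family :: "nat \<Rightarrow> (real \<Rightarrow> complex) \<Rightarrow> phase_pt set set \<Rightarrow> bool" where
  "hyperbolic_family n \<Gamma> \<F> \<longleftrightarrow> (\<forall>S\<in>\<F>. hyperbolic_orbit n \<Gamma> S)"

definition elliptic_hyperbolic_ovals :: "nat \<Rightarrow> (real \<Rightarrow> complex) set" where
  "elliptic_hyperbolic_ovals n = {\<Gamma> \<in> sym_ovals n.
     (\<exists>\<F>\<in>sym_families n \<Gamma>. elliptic_family n \<Gamma> \<F>) \<and>
     (\<exists>\<F>\<in>sym_families n \<Gamma>. hyperbolic_family n \<Gamma> \<F>)}"

end

theory Submission
  imports Defs
begin

text \<open>At a critical point \<open>\<phi>\<close> of the support function \<open>g\<close>, with radius of curvature
  \<open>R = g + g''\<close>, the derivative of every quotient map \<open>T\<^sub>m\<close> at \<open>(\<phi>, cos (m \<pi> / n))\<close> has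
  determinant \<open>1\<close> and both diagonal entries equal to \<open>2 g / R - 1 > -1\<close>, independently of \<open>m\<close>.
  So the whole family is elliptic if \<open>g'' > 0\<close>, hyperbolic if \<open>g'' < 0\<close> and neither if
  \<open>g'' = 0\<close>: the ovals in question are those whose support function has a critical point with
  \<open>g'' > 0\<close> and one with \<open>g'' < 0\<close>.  Such critical points survive \<open>C\<^sup>2\<close>-small perturbations, and
  a small periodic bump makes a global maximum and a global minimum of any \<open>g\<close> nondegenerate.

  The derivative of \<open>T\<^sub>m\<close> is found without solving for the next impact: the outgoing cosine at
  either end of a chord is an explicit function of the two endpoint parameters \<open>(\<phi>, \<psi>)\<close>, so
  that the billiard map is \<open>chord_end \<circ> chord_start\<^sup>-\<^sup>1\<close>, and strict convexity makes
  \<open>chord_start\<close> injective.\<close>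


section \<open>Smooth periodic functions\<close>


text \<open>All of the local dynamics is governed by one number, \<rho> = R / (2 g): a symmetric
  chord has length 2 g sin \<alpha> and makes the angle \<alpha> with both tangents, and the equal
  diagonal entries come out as (1 - \<rho>) / \<rho>. Two obstacles shape the middle of the proof.
  \<open>billiard_map\<close> is a definite description whose differentiability is nowhere given;
  injectivity of \<open>chord_start\<close> and invariance of domain provide an inverse on an open
  set, and then its derivative at the single point of interest is enough. Moreover,
  \<open>elliptic_fixpoint\<close> and \<open>hyperbolic_fixpoint\<close> ask for some derivative,
  so excluding a type requires local lifts to be unique; this rests on the fibres of the quotient
  being discrete, with gaps of at least 2 \<pi> / n. Finally, symmetry of an oval is given as
  invariance of its image only; strict convexity turns it into equivariance of the tangent-angle
  parametrization, from which the periodicity of g follows.\<close>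

lemma nderiv_0 [simp]: "nderiv 0 f = f"
  by (simp add: nderiv_def)

lemma nderiv_Suc: "nderiv (Suc k) f = (\<lambda>x. vector_derivative (nderiv k f) (at x))"
  by (simp add: nderiv_def)

lemma nderiv_nderiv: "nderiv j (nderiv k f) = nderiv (j + k) f"
  by (simp add: nderiv_def funpow_add)

lemma nderiv_Suc_eqI:
  assumes "nderiv k f = u" "\<And>x. (u has_vector_derivative v x) (at x)"
  shows "nderiv (Suc k) f = v"
  using assms by (auto simp: nderiv_Suc intro!: vector_derivative_at)

lemma C_infinity_has_vector_derivative:
  assumes "C_infinity f"
  shows "(nderiv k f has_vector_derivative nderiv (Suc k) f x) (at x)"
  using assms by (simp add: C_infinity_def nderiv_Suc vector_derivative_works)

lemma C_infinity_has_real_derivative: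
  fixes f :: "real \<Rightarrow> real"
  assumes "C_infinity f"
  shows "(nderiv k f has_real_derivative nderiv (Suc k) f x) (at x)"
  using C_infinity_has_vector_derivative[OF assms]
  by (simp add: has_real_derivative_iff_has_vector_derivative)

lemma C_infinity_nderiv:
  assumes "C_infinity f"
  shows "C_infinity (nderiv k f)"
  using assms by (simp add: C_infinity_def nderiv_nderiv)

lemma C_infinity_isCont:
  assumes "C_infinity f"
  shows "isCont (nderiv k f) x"
  using assms by (simp add: C_infinity_def differentiable_imp_continuous_within)

text \<open>Every iterated derivative stays in S, so a family closed under differentiation replaces
  closed forms for higher derivatives. Typical families are multiples of \<open>cis\<close>, scaled
  and shifted cosines, and \<open>leibniz_span\<close>.\<close>

lemma C_infinity_coinduct:
  assumes "f \<in> S"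
    and "\<And>h. h \<in> S \<Longrightarrow> \<exists>h'\<in>S. \<forall>x. (h has_vector_derivative h' x) (at x)"
  shows "C_infinity f"
proof -
  have "nderiv k f \<in> S" for k
  proof (induction k)
    case (Suc k)
    then obtain h' where "h' \<in> S" "\<forall>x. (nderiv k f has_vector_derivative h' x) (at x)"
      using assms(2) by blast
    then show ?case using nderiv_Suc_eqI[OF refl, of k f h'] by simp
  qed (use assms in simp)
  then show ?thesis
    unfolding C_infinity_def using assms(2) by (meson vector_derivative_works differentiableI_vector)
qed

lemma C_infinity_const: "C_infinity (\<lambda>_. c)"
  by (rule C_infinity_coinduct[of _ "range (\<lambda>c _. c)"]) (auto intro!: exI[of _ 0])

lemma C_infinity_add:
  assumes "C_infinity f" "C_infinity g"
  shows "C_infinity (\<lambda>x. f x + g x)"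
proof (rule C_infinity_coinduct[of _ "range (\<lambda>k x. nderiv k f x + nderiv k g x)"])
  show "(\<lambda>x. f x + g x) \<in> range (\<lambda>k x. nderiv k f x + nderiv k g x)"
    by (rule range_eqI[of _ _ 0]) simp
  fix h assume "h \<in> range (\<lambda>k x. nderiv k f x + nderiv k g x)"
  then obtain k where "h = (\<lambda>x. nderiv k f x + nderiv k g x)" by auto
  then show "\<exists>h'\<in>range (\<lambda>k x. nderiv k f x + nderiv k g x).
      \<forall>x. (h has_vector_derivative h' x) (at x)"
    using assms
    by (auto intro!: bexI[of _ "\<lambda>x. nderiv (Suc k) f x + nderiv (Suc k) g x"]
        has_vector_derivative_add C_infinity_has_vector_derivative)
qed

text \<open>Closed under differentiation by the product rule, with repeated summands in place of
  binomial coefficients. An abstract \<open>prod\<close> lets one smoothness proof serve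
  multiplication, scaling and the inner product.\<close>

inductive_set leibniz_span ::
  "('a::real_normed_vector \<Rightarrow> 'b::real_normed_vector \<Rightarrow> 'c::real_normed_vector) \<Rightarrow>
    (real \<Rightarrow> 'a) \<Rightarrow> (real \<Rightarrow> 'b) \<Rightarrow> (real \<Rightarrow> 'c) set"
  for prod f g where
    product: "(\<lambda>x. prod (nderiv i f x) (nderiv j g x)) \<in> leibniz_span prod f g"
  | add: "\<lbrakk>u \<in> leibniz_span prod f g; v \<in> leibniz_span prod f g\<rbrakk>
      \<Longrightarrow> (\<lambda>x. u x + v x) \<in> leibniz_span prod f g"

lemma (in bounded_bilinear) C_infinity_prod:
  assumes "C_infinity f" "C_infinity g"
  shows "C_infinity (\<lambda>x. prod (f x) (g x))"
proof (rule C_infinity_coinduct[of _ "leibniz_span prod f g"])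
  show "(\<lambda>x. prod (f x) (g x)) \<in> leibniz_span prod f g"
    using leibniz_span.product[of prod 0 f 0 g] by simp
  show "\<exists>h'\<in>leibniz_span prod f g. \<forall>x. (h has_vector_derivative h' x) (at x)"
    if "h \<in> leibniz_span prod f g" for h
    using that
  proof induction
    case (product i j)
    let ?h' = "\<lambda>x. prod (nderiv i f x) (nderiv (Suc j) g x) + prod (nderiv (Suc i) f x) (nderiv j g x)"
    have "?h' \<in> leibniz_span prod f g"
      by (intro leibniz_span.intros)
    moreover have "((\<lambda>x. prod (nderiv i f x) (nderiv j g x)) has_vector_derivative ?h' x) (at x)" for x
      by (intro has_vector_derivative C_infinity_has_vector_derivative assms)
    ultimately show ?case by (intro bexI[of _ ?h'] allI)
  next
    case (add u v)
    then obtain u' v' where "u' \<in> leibniz_span prod f g" "v' \<in> leibniz_span prod f g"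
      "\<forall>x. (u has_vector_derivative u' x) (at x)" "\<forall>x. (v has_vector_derivative v' x) (at x)"
      by blast
    then show ?case
      by (intro bexI[of _ "\<lambda>x. u' x + v' x"])
        (auto intro: has_vector_derivative_add leibniz_span.add)
  qed
qed

lemmas C_infinity_mult = bounded_bilinear.C_infinity_prod[OF bounded_bilinear_mult]
lemmas C_infinity_scaleR = bounded_bilinear.C_infinity_prod[OF bounded_bilinear_scaleR]
lemmas C_infinity_inner = bounded_bilinear.C_infinity_prod[OF bounded_bilinear_inner]

lemma C_infinity_minus:
  fixes f :: "real \<Rightarrow> 'a::real_normed_vector"
  assumes "C_infinity f"
  shows "C_infinity (\<lambda>x. - f x)"
  using C_infinity_scaleR[OF C_infinity_const[of "-1"] assms] by simp

lemma has_vector_derivative_cis: "(cis has_vector_derivative \<i> * cis x) (at x)"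
proof -
  have "((\<lambda>x. exp (\<i> * complex_of_real x)) has_vector_derivative \<i> * exp (\<i> * complex_of_real x)) (at x)"
    by (rule has_vector_derivative_real_field) (auto intro!: derivative_eq_intros)
  then show ?thesis by (simp add: cis_conv_exp[abs_def])
qed

lemma C_infinity_cis: "C_infinity cis"
proof (rule C_infinity_coinduct[of _ "range (\<lambda>c x. c * cis x)"])
  show "cis \<in> range (\<lambda>c x. c * cis x)"
    by (rule range_eqI[of _ _ 1]) auto
  fix h assume "h \<in> range (\<lambda>c x. c * cis x)"
  then obtain c where "h = (\<lambda>x. c * cis x)" by auto
  then show "\<exists>h'\<in>range (\<lambda>c x. c * cis x). \<forall>x. (h has_vector_derivative h' x) (at x)"
    using has_vector_derivative_mult_right[OF has_vector_derivative_cis]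
    by (auto intro!: exI[of _ "c * \<i>"] simp: mult.assoc)
qed

lemma C_infinity_cos: "C_infinity (\<lambda>x. cos (a * x + b))"
proof (rule C_infinity_coinduct[of _ "range (\<lambda>(c, b) x. c * cos (a * x + b))"])
  show "(\<lambda>x. cos (a * x + b)) \<in> range (\<lambda>(c, b) x. c * cos (a * x + b))"
    by (rule range_eqI[of _ _ "(1, b)"]) auto
  fix h assume "h \<in> range (\<lambda>(c, b) x. c * cos (a * x + b))"
  then obtain c b where h: "h = (\<lambda>x. c * cos (a * x + b))" by auto
  \<comment> \<open>Up to the factor \<open>a\<close>, differentiation is a quarter-turn shift of
    the phase, so cosines alone form a closed family.\<close>
  have "(h has_vector_derivative (c * a) * cos (a * x + (b + pi / 2))) (at x)" for x
    unfolding h has_real_derivative_iff_has_vector_derivative[symmetric]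
    by (auto intro!: derivative_eq_intros simp: cos_add sin_add algebra_simps)
  moreover have "(\<lambda>x. (c * a) * cos (a * x + (b + pi / 2))) \<in> range (\<lambda>(c, b) x. c * cos (a * x + b))"
    by (rule range_eqI[of _ _ "(c * a, b + pi / 2)"]) auto
  ultimately show "\<exists>h'\<in>range (\<lambda>(c, b) x. c * cos (a * x + b)).
      \<forall>x. (h has_vector_derivative h' x) (at x)"
    by (intro bexI[of _ "\<lambda>x. (c * a) * cos (a * x + (b + pi / 2))"] allI)
qed

lemma periodic_nderiv:
  assumes "C_infinity f" "periodic P f"
  shows "periodic P (nderiv k f)"
proof (induction k)
  case (Suc k)
  have "((\<lambda>y. nderiv k f (y + P)) has_vector_derivative nderiv (Suc k) f (x + P)) (at x)" for x
    using vector_diff_chain_at[of "\<lambda>y. y + P" 1 x "nderiv k f"]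
      has_vector_derivative_add_const[of "\<lambda>y. y" P 1 "at x"]
      C_infinity_has_vector_derivative[OF assms(1), of k "x + P"]
    by (simp add: o_def has_vector_derivative_id[unfolded id_def])
  moreover have "(\<lambda>y. nderiv k f (y + P)) = nderiv k f"
    using Suc by (simp add: periodic_def)
  ultimately have "(nderiv k f has_vector_derivative nderiv (Suc k) f (x + P)) (at x)" for x
    by simp
  then show ?case
    using C_infinity_has_vector_derivative[OF assms(1)]
    by (auto simp: periodic_def intro: vector_derivative_unique_at)
qed (use assms in simp)

lemma periodic_nat:
  assumes "periodic P f"
  shows "f (x + real j * P) = f x"
proof (induction j)
  case (Suc j)
  have "f (x + real j * P + P) = f (x + real j * P)"
    using assms by (simp add: periodic_def)
  then show ?case using Suc by (simp add: algebra_simps)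
qed simp

lemma periodic_int:
  assumes "periodic P f"
  shows "f (x + of_int j * P) = f x"
proof (cases "j \<ge> 0")
  case True
  then show ?thesis using periodic_nat[OF assms, of x "nat j"] by simp
next
  case False
  then show ?thesis using periodic_nat[OF assms, of "x + of_int j * P" "nat (- j)"] by simp
qed

lemma period_representative:
  fixes P :: real
  assumes "P > 0"
  obtains j :: int where "x + of_int j * P \<in> {y..<y + P}"
proof
  have "of_int \<lfloor>(x - y) / P\<rfloor> \<le> (x - y) / P" "(x - y) / P < of_int \<lfloor>(x - y) / P\<rfloor> + 1"
    by linarith+
  then have "of_int \<lfloor>(x - y) / P\<rfloor> * P \<le> x - y" "x - y < (of_int \<lfloor>(x - y) / P\<rfloor> + 1) * P"
    using assms by (simp_all only: pos_le_divide_eq pos_divide_less_eq)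
  then show "x + of_int (- \<lfloor>(x - y) / P\<rfloor>) * P \<in> {y..<y + P}"
    by (simp add: algebra_simps)
qed

lemma periodic_extrema:
  fixes f :: "real \<Rightarrow> real"
  assumes "periodic P f" "P > 0" "\<And>x. isCont f x"
  shows "\<exists>a. \<forall>x. f x \<le> f a" "\<exists>b. \<forall>x. f b \<le> f x"
proof -
  have c: "continuous_on {0..P} f"
    using assms by (simp add: continuous_at_imp_continuous_on)
  obtain a where a: "\<And>x. x \<in> {0..P} \<Longrightarrow> f x \<le> f a"
    using continuous_attains_sup[OF compact_Icc _ c] assms(2) by fastforce
  obtain b where b: "\<And>x. x \<in> {0..P} \<Longrightarrow> f b \<le> f x"
    using continuous_attains_inf[OF compact_Icc _ c] assms(2) by fastforce
  have rep: "\<exists>y\<in>{0..P}. f y = f x" for x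
  proof -
    obtain j :: int where "x + of_int j * P \<in> {0..<0 + P}"
      using period_representative[OF assms(2)] .
    then show ?thesis
      using periodic_int[OF assms(1), of x j] by (auto intro!: bexI[of _ "x + of_int j * P"])
  qed
  have "f x \<le> f a \<and> f b \<le> f x" for x
    using rep[of x] a b by metis
  then show "\<exists>a. \<forall>x. f x \<le> f a" "\<exists>b. \<forall>x. f b \<le> f x" by blast+
qed


section \<open>Convexity and symmetry of ovals\<close>


lemma norm_frame [simp]: "norm (tangent x) = 1" "norm (normal x) = 1"
  by (simp_all add: tangent_def normal_def norm_mult)

lemma inner_frame:
  "inner (tangent x) (tangent y) = cos (x - y)"
  "inner (tangent x) (normal y) = sin (x - y)"
  "inner (normal x) (tangent y) = sin (y - x)"
  "inner (normal x) (normal y) = cos (x - y)"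
  by (simp_all add: tangent_def normal_def inner_complex_def cos_diff sin_diff algebra_simps)

lemma frame_expansion:
  "z = inner z (tangent x) *\<^sub>R tangent x + inner z (normal x) *\<^sub>R normal x"
proof -
  have *: "(a * c + b * s) * c + (b * c - a * s) * - s = a * (c\<^sup>2 + s\<^sup>2)"
    "(a * c + b * s) * s + (b * c - a * s) * c = b * (c\<^sup>2 + s\<^sup>2)" for a b c s :: real
    by (simp_all add: power2_eq_square algebra_simps)
  show ?thesis
    using *[of "Re z" "cos x" "Im z" "sin x"]
    by (simp add: complex_eq_iff tangent_def normal_def inner_complex_def)
qed

lemma norm_frame_expansion: "(norm z)\<^sup>2 = (inner z (tangent x))\<^sup>2 + (inner z (normal x))\<^sup>2"
proof -
  have "(norm z)\<^sup>2 = inner z (inner z (tangent x) *\<^sub>R tangent x + inner z (normal x) *\<^sub>R normal x)"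
    using frame_expansion[of z x] by (simp add: dot_square_norm)
  then show ?thesis by (simp add: inner_add_right power2_eq_square)
qed

lemma inner_mult_unit:
  fixes u z w :: complex
  assumes "norm u = 1"
  shows "inner (u * z) (u * w) = inner z w"
proof -
  have "(Re u)\<^sup>2 + (Im u)\<^sup>2 = 1"
    using assms by (simp add: cmod_def)
  moreover have "inner (u * z) (u * w) = ((Re u)\<^sup>2 + (Im u)\<^sup>2) * inner z w"
    by (simp add: inner_complex_def power2_eq_square algebra_simps)
  ultimately show ?thesis by simp
qed

lemma frame_rotate:
  "tangent (x + a) = cis a * tangent x" "normal (x + a) = cis a * normal x"
  by (simp_all add: tangent_def normal_def cis_mult[symmetric] algebra_simps)

lemma has_vector_derivative_frame:
  "(tangent has_vector_derivative normal x) (at x)"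
  "(normal has_vector_derivative - tangent x) (at x)"
proof -
  show "(tangent has_vector_derivative normal x) (at x)"
    using has_vector_derivative_cis by (simp add: tangent_def[abs_def] normal_def)
  show "(normal has_vector_derivative - tangent x) (at x)"
    using has_vector_derivative_mult_right[OF has_vector_derivative_cis, of \<i> x]
    by (simp add: tangent_def normal_def[abs_def] mult.assoc[symmetric])
qed

lemma C_infinity_frame: "C_infinity tangent" "C_infinity normal"
  using C_infinity_cis C_infinity_mult[OF C_infinity_const C_infinity_cis]
  by (simp_all add: tangent_def[abs_def] normal_def[abs_def])

lemma cis_eq_imp_shift:
  assumes "cis x = cis y"
  obtains j :: int where "x = y + of_int j * (2 * pi)"
proof -
  have "cos (x - y) = 1"
    using arg_cong2[OF assms assms, of inner] by (metis inner_frame(1) tangent_def assms cos_zero diff_self)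
  then show ?thesis using that by (auto simp: cos_one_2pi_int algebra_simps)
qed

lemma cis_shift: "cis (x + of_int j * (2 * pi)) = cis x"
proof -
  have "cis (of_int j * (2 * pi)) = 1"
    using cis_multiple_2pi[of "of_int j"] by (simp add: mult.commute mult.left_commute)
  then show ?thesis by (simp add: cis_mult[symmetric])
qed

lemma cis_distinct:
  assumes "x < y" "y < x + 2 * pi"
  shows "cis x \<noteq> cis y"
proof
  assume "cis x = cis y"
  then obtain j :: int where "y = x + of_int j * (2 * pi)"
    using cis_eq_imp_shift by metis
  with assms have "0 < real_of_int j * (2 * pi)" "real_of_int j * (2 * pi) < 1 * (2 * pi)" by auto
  then show False unfolding mult_less_cancel_right by (simp add: zero_less_mult_iff)
qed

section \<open>Support function and strict convexity of an oval\<close>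

definition curvature_radius :: "(real \<Rightarrow> complex) \<Rightarrow> real \<Rightarrow> real" where
  "curvature_radius \<Gamma> \<phi> = support_fun \<Gamma> \<phi> + nderiv 2 (support_fun \<Gamma>) \<phi>"

context
  fixes \<Gamma> :: "real \<Rightarrow> complex"
  assumes oval: "oval \<Gamma>"
begin

lemma C_infinity_support_fun: "C_infinity (support_fun \<Gamma>)"
  unfolding support_fun_def[abs_def] using oval
  by (intro C_infinity_minus C_infinity_inner C_infinity_frame) (simp add: oval_def)

lemma oval_period: "\<Gamma> (x + of_int j * (2 * pi)) = \<Gamma> x"
  using oval periodic_int by (auto simp: oval_def)

lemma oval_cong: "cis x = cis y \<Longrightarrow> \<Gamma> x = \<Gamma> y"
  by (metis cis_eq_imp_shift oval_period)

text \<open>Since \<Gamma>' = R \<sigma> is orthogonal to the normal \<eta>, and \<eta>' = -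
  \<sigma>, differentiating g = - <\<Gamma>, \<eta>> gives g' = <\<Gamma>, \<sigma>> and then g'' =
  R - g. So the radius that \<open>oval\<close> merely asserts to exist is
  \<open>curvature_radius\<close>.\<close>

lemma nderiv_support_fun:
  "nderiv (Suc 0) (support_fun \<Gamma>) = (\<lambda>x. inner (\<Gamma> x) (tangent x))" (is ?first)
  and oval_derivative:
  "(\<Gamma> has_vector_derivative curvature_radius \<Gamma> x *\<^sub>R tangent x) (at x)" (is ?deriv)
  and curvature_radius_pos: "curvature_radius \<Gamma> x > 0" (is ?pos)
proof -
  obtain R where R: "\<And>x. R x > 0" "\<And>x. (\<Gamma> has_vector_derivative R x *\<^sub>R tangent x) (at x)"
    using oval unfolding oval_def by metis
  note inner_deriv = bounded_bilinear.has_vector_derivative[OF bounded_bilinear_inner R(2)]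
  have "(support_fun \<Gamma> has_vector_derivative inner (\<Gamma> x) (tangent x)) (at x)" for x
    using has_vector_derivative_minus[OF inner_deriv[OF has_vector_derivative_frame(2)]]
    by (simp add: support_fun_def[abs_def] inner_frame)
  then show first: ?first
    by (rule nderiv_Suc_eqI[OF nderiv_0])
  have "((\<lambda>x. inner (\<Gamma> x) (tangent x)) has_vector_derivative R x - support_fun \<Gamma> x) (at x)" for x
    using inner_deriv[OF has_vector_derivative_frame(1)]
    by (simp add: support_fun_def inner_frame add.commute)
  then have "nderiv (Suc (Suc 0)) (support_fun \<Gamma>) = (\<lambda>x. R x - support_fun \<Gamma> x)"
    using nderiv_Suc_eqI[OF first] by simp
  then have "curvature_radius \<Gamma> = R"
    by (simp add: curvature_radius_def[abs_def] numeral_2_eq_2)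
  then show ?deriv ?pos using R by auto
qed

lemma oval_eq_support:
  "\<Gamma> x = nderiv (Suc 0) (support_fun \<Gamma>) x *\<^sub>R tangent x - support_fun \<Gamma> x *\<^sub>R normal x"
  using frame_expansion[of "\<Gamma> x" x] by (simp add: nderiv_support_fun support_fun_def)

lemma support_critical_iff: "support_critical \<Gamma> x \<longleftrightarrow> nderiv (Suc 0) (support_fun \<Gamma>) x = 0"
  unfolding support_critical_def
  using C_infinity_has_real_derivative[OF C_infinity_support_fun, of 0 x] DERIV_unique
  by fastforce

text \<open>The height of \<Gamma> x over the tangent line at y has derivative R(x) sin (x - y): it
  climbs from 0 during the half turn after y and descends to 0 during the next one, hence is
  positive in between.\<close>

lemma oval_strictly_convex:
  assumes "cis x \<noteq> cis y"
  shows "inner (\<Gamma> x - \<Gamma> y) (normal y) > 0"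
proof -
  define f where "f x = inner (\<Gamma> x - \<Gamma> y) (normal y)" for x
  have deriv: "(f has_real_derivative curvature_radius \<Gamma> x * sin (x - y)) (at x)" for x
  proof -
    have "(f has_vector_derivative inner (\<Gamma> x - \<Gamma> y) 0 +
        inner (curvature_radius \<Gamma> x *\<^sub>R tangent x - 0) (normal y)) (at x)"
      unfolding f_def
      by (intro bounded_bilinear.has_vector_derivative[OF bounded_bilinear_inner]
          has_vector_derivative_diff oval_derivative has_vector_derivative_const)
    then show ?thesis by (simp add: has_real_derivative_iff_has_vector_derivative inner_frame)
  qed
  have cont: "continuous_on A f" for A
    using deriv DERIV_isCont continuous_at_imp_continuous_on by blast
  obtain j :: int where "x + of_int j * (2 * pi) \<in> {y..<y + 2 * pi}"
    using period_representative[of "2 * pi"] by auto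
  moreover define x' where "x' = x + of_int j * (2 * pi)"
  moreover have "x' \<noteq> y" using assms cis_shift by (auto simp: x'_def)
  ultimately have x': "y < x'" "x' < y + 2 * pi" by auto
  have "f x' > 0"
  proof (cases "x' \<le> y + pi")
    case True
    have "f y < f x'"
    proof (rule DERIV_pos_imp_increasing_open[OF x'(1) _ cont])
      fix z assume "y < z" "z < x'"
      then have "sin (z - y) > 0" using True by (intro sin_gt_zero) auto
      then show "\<exists>d. (f has_real_derivative d) (at z) \<and> d > 0"
        using deriv curvature_radius_pos by (metis mult_pos_pos)
    qed
    then show ?thesis by (simp add: f_def)
  next
    case False
    \<comment> \<open>Past the half turn the comparison is with the far end y + 2 \<pi>, where by
      periodicity the height is 0 again.\<close>
    have "f x' > f (y + 2 * pi)"
    proof (rule DERIV_neg_imp_decreasing_open[OF x'(2) _ cont])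
      fix z assume "x' < z" "z < y + 2 * pi"
      then have "sin (z - y) < 0" using False by (intro sin_lt_zero) auto
      then show "\<exists>d. (f has_real_derivative d) (at z) \<and> d < 0"
        using deriv curvature_radius_pos by (metis mult_pos_neg)
    qed
    then show ?thesis using oval_period[of y 1] by (simp add: f_def)
  qed
  then show ?thesis using oval_period[of x j] by (simp add: f_def x'_def)
qed

lemma oval_convex: "inner (\<Gamma> x - \<Gamma> y) (normal y) \<ge> 0"
  using oval_strictly_convex[of x y] oval_cong[of x y] by (cases "cis x = cis y") auto

end

section \<open>Consequences of the rotational symmetry\<close>

context
  fixes n :: nat and \<Gamma> :: "real \<Rightarrow> complex"
  assumes sym: "\<Gamma> \<in> sym_ovals n"
begin

lemma sym_oval: "oval \<Gamma>"
  using sym by (simp add: sym_ovals_def)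

text \<open>Among all points of the curve, \<Gamma> y is the only minimizer of the product with
  \<open>normal y\<close>. A rotation preserving the curve carries the minimizer for
  \<open>normal x\<close> to the one for the rotated normal, and so it respects the parameter and
  not just the image.\<close>

lemma sym_oval_rotate: "\<Gamma> (x + 2 * pi / n) = cis (2 * pi / n) * \<Gamma> x"
proof -
  let ?P = "2 * pi / n"
  have range: "(\<lambda>z. cis ?P * z) ` range \<Gamma> = range \<Gamma>"
    using sym by (simp add: sym_ovals_def)
  then have "\<exists>u. cis ?P * \<Gamma> x = \<Gamma> u" "\<exists>v. \<Gamma> (x + ?P) = cis ?P * \<Gamma> v"
    by (auto simp: image_iff set_eq_iff)
  then obtain u v where u: "cis ?P * \<Gamma> x = \<Gamma> u" and v: "\<Gamma> (x + ?P) = cis ?P * \<Gamma> v"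
    by blast
  have "inner (\<Gamma> u - \<Gamma> (x + ?P)) (normal (x + ?P)) = inner (\<Gamma> x - \<Gamma> v) (normal x)"
    by (simp add: frame_rotate v u[symmetric] right_diff_distrib[symmetric] inner_mult_unit)
  also have "\<dots> \<le> 0"
    using oval_convex[OF sym_oval, of v x] by (simp add: inner_diff_left)
  finally have "cis u = cis (x + ?P)"
    using oval_strictly_convex[OF sym_oval] by force
  then show ?thesis using u oval_cong[OF sym_oval] by metis
qed

lemma sym_oval_rotate_int: "\<Gamma> (x + of_int j * (2 * pi / n)) = cis (of_int j * (2 * pi / n)) * \<Gamma> x"
proof -
  let ?P = "2 * pi / n"
  \<comment> \<open>Seen in the rotating frame the curve is periodic, so \<open>periodic_int\<close>
    covers positive and negative j alike.\<close>
  have "periodic ?P (\<lambda>x. cis (- x) * \<Gamma> x)"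
    by (simp add: periodic_def sym_oval_rotate mult.assoc[symmetric] cis_mult)
  from periodic_int[OF this, of x j]
  have "cis (x + of_int j * ?P) * (cis (- (x + of_int j * ?P)) * \<Gamma> (x + of_int j * ?P)) =
      cis (x + of_int j * ?P) * (cis (- x) * \<Gamma> x)"
    by simp
  then show ?thesis by (simp add: mult.assoc[symmetric] cis_mult)
qed

lemma support_fun_periodic: "periodic (2 * pi / n) (support_fun \<Gamma>)"
  by (simp add: periodic_def support_fun_def sym_oval_rotate frame_rotate inner_mult_unit)

text \<open>The n rotated copies of \<Gamma> x sum to 0. If g x \<le> 0, convexity would put all of
  them on the nonnegative side of the line through the origin parallel to the tangent, one of them
  strictly, and the sum could not vanish.\<close>

lemma support_fun_pos:
  assumes "n \<ge> 2"
  shows "support_fun \<Gamma> x > 0"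
proof (rule ccontr)
  let ?w = "cis (2 * pi / n)"
  assume neg: "\<not> support_fun \<Gamma> x > 0"
  have "?w ^ n = 1" using assms by (simp only: Complex.DeMoivre) simp
  have "cos (2 * pi / n) < cos 0"
    using assms by (intro cos_monotone_0_pi) (auto simp: field_simps)
  then have "?w \<noteq> 1" by (auto simp: complex_eq_iff)
  then have "(\<Sum>j<n. ?w ^ j) = 0"
    using geometric_sum[of ?w n] \<open>?w ^ n = 1\<close> by simp
  then have "0 = (\<Sum>j<n. inner (?w ^ j * \<Gamma> x) (normal x))"
    by (simp add: inner_sum_left[symmetric] sum_distrib_right[symmetric])
  also have "\<dots> = (\<Sum>j<n. inner (\<Gamma> (x + real j * (2 * pi / n))) (normal x))"
    using sym_oval_rotate_int[of x "int _"] by (simp add: Complex.DeMoivre)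
  also have "\<dots> > 0"
  \<comment> \<open>The copy j = 1 is the strict one: for n \<ge> 2 it is the image under a
    nontrivial rotation.\<close>
  proof (rule sum_pos2[of _ 1])
    have "cis (x + real 1 * (2 * pi / n)) \<noteq> cis x"
      using \<open>?w \<noteq> 1\<close> by (simp add: cis_mult[symmetric])
    then show "0 < inner (\<Gamma> (x + real 1 * (2 * pi / n))) (normal x)"
      using oval_strictly_convex[OF sym_oval] neg by (force simp: inner_diff_left support_fun_def)
    show "0 \<le> inner (\<Gamma> (x + real j * (2 * pi / n))) (normal x)" for j
      using oval_convex[OF sym_oval, of "x + real j * (2 * pi / n)" x] neg
      by (simp add: inner_diff_left support_fun_def)
  qed (use assms in auto)
  finally show False by simp
qed

lemma support_fun_in_support_space:
  assumes "n \<ge> 2"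
  shows "support_fun \<Gamma> \<in> support_space n"
  using C_infinity_support_fun support_fun_periodic support_fun_pos[OF assms]
    curvature_radius_pos sym_oval
  by (simp add: support_space_def curvature_radius_def)

end

text \<open>Surjectivity of the support map, through which a perturbation of g becomes one of the
  oval. In \<Gamma> = g' \<sigma> - g \<eta> the terms g' \<eta> cancel upon differentiation,
  leaving (g + g'') \<sigma>.\<close>

lemma support_space_realization:
  assumes "n \<ge> 2" "g \<in> support_space n"
  obtains \<Gamma> where "\<Gamma> \<in> sym_ovals n" "support_fun \<Gamma> = g"
proof -
  define \<Gamma> where "\<Gamma> x = nderiv (Suc 0) g x *\<^sub>R tangent x + (- g x) *\<^sub>R normal x" for x
  have g: "C_infinity g" "periodic (2 * pi / n) g" "\<And>x. g x + nderiv 2 g x > 0"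
    using assms by (auto simp: support_space_def)
  have "C_infinity \<Gamma>"
    unfolding \<Gamma>_def[abs_def]
    by (intro C_infinity_add C_infinity_scaleR C_infinity_minus C_infinity_nderiv C_infinity_frame g)
  have "(\<Gamma> has_vector_derivative (g x + nderiv 2 g x) *\<^sub>R tangent x) (at x)" for x
  proof -
    have "(\<Gamma> has_vector_derivative (nderiv (Suc 0) g x *\<^sub>R normal x + nderiv (Suc (Suc 0)) g x *\<^sub>R tangent x) +
        ((- g x) *\<^sub>R (- tangent x) + (- nderiv (Suc 0) g x) *\<^sub>R normal x)) (at x)"
      unfolding \<Gamma>_def[abs_def]
      using C_infinity_has_vector_derivative[OF g(1), of 0]
      by (intro has_vector_derivative_add bounded_bilinear.has_vector_derivative[OF bounded_bilinear_scaleR]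
          has_vector_derivative_minus has_vector_derivative_frame
          C_infinity_has_vector_derivative g) simp
    then show ?thesis by (simp add: algebra_simps numeral_2_eq_2)
  qed
  moreover have rotate: "\<Gamma> (x + 2 * pi / n) = cis (2 * pi / n) * \<Gamma> x" for x
    using g(2) periodic_nderiv[OF g(1,2), of "Suc 0"]
    by (simp add: \<Gamma>_def frame_rotate periodic_def scaleR_conv_of_real algebra_simps)
  moreover have "periodic (2 * pi) \<Gamma>"
  proof -
    have "g (x + 2 * pi) = g x" "nderiv (Suc 0) g (x + 2 * pi) = nderiv (Suc 0) g x" for x
      using periodic_nat[OF g(2), of x n] periodic_nat[OF periodic_nderiv[OF g(1,2)], of "Suc 0" x n] assms
      by simp_all
    then show ?thesis
      by (simp add: periodic_def \<Gamma>_def frame_rotate)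
  qed
  ultimately have "oval \<Gamma>"
    using \<open>C_infinity \<Gamma>\<close> g(3) unfolding oval_def by blast
  moreover have "(\<lambda>z. cis (2 * pi / n) * z) ` range \<Gamma> = range \<Gamma>"
  proof -
    have "(\<lambda>z. cis (2 * pi / n) * z) ` range \<Gamma> = range (\<lambda>x. \<Gamma> (x + 2 * pi / n))"
      by (auto simp: rotate)
    also have "\<dots> = range \<Gamma>"
      by (metis fun.set_map surj_plus_right image_image)
    finally show ?thesis .
  qed
  moreover have "support_fun \<Gamma> = g"
    by (rule ext) (simp add: support_fun_def \<Gamma>_def inner_diff_left inner_frame)
  ultimately show ?thesis using that by (simp add: sym_ovals_def)
qed


section \<open>Chords and the quotient maps\<close>


definition chord_dir :: "(real \<Rightarrow> complex) \<Rightarrow> real \<times> real \<Rightarrow> complex" where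
  "chord_dir \<Gamma> w = (\<Gamma> (snd w) - \<Gamma> (fst w)) /\<^sub>R norm (\<Gamma> (snd w) - \<Gamma> (fst w))"

definition chord_start :: "(real \<Rightarrow> complex) \<Rightarrow> real \<times> real \<Rightarrow> real \<times> real" where
  "chord_start \<Gamma> w = (fst w, inner (chord_dir \<Gamma> w) (tangent (fst w)))"

text \<open>Reflection reverses only the normal component, so the outgoing cosine at the far end is
  the tangential component of the incoming direction.\<close>

definition chord_end :: "(real \<Rightarrow> complex) \<Rightarrow> real \<times> real \<Rightarrow> real \<times> real" where
  "chord_end \<Gamma> w = (snd w, inner (chord_dir \<Gamma> w) (tangent (snd w)))"

lemma inner_direction_tangent: "inner (direction \<phi> \<alpha>) (tangent \<phi>) = cos \<alpha>"
  by (simp add: direction_def inner_add_left inner_frame)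

lemma direction_cong: "cis \<phi> = cis \<psi> \<Longrightarrow> direction \<phi> = direction \<psi>"
  by (auto simp: direction_def tangent_def normal_def)

text \<open>Pointing inward fixes the sign of the square root in sin (arccos p), so a unit vector is
  recovered from its tangential component alone.\<close>

lemma direction_arccos:
  assumes "norm d = 1" "inner d (normal \<phi>) > 0"
  shows "direction \<phi> (arccos (inner d (tangent \<phi>))) = d"
    and "arccos (inner d (tangent \<phi>)) \<in> {0<..<pi}"
    and "\<bar>inner d (tangent \<phi>)\<bar> < 1"
proof -
  have eq: "(inner d (tangent \<phi>))\<^sup>2 + (inner d (normal \<phi>))\<^sup>2 = 1"
    using norm_frame_expansion[of d \<phi>] assms(1) by simp
  moreover have "(inner d (normal \<phi>))\<^sup>2 > 0" using assms(2) by simp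
  ultimately have "(inner d (tangent \<phi>))\<^sup>2 < 1" by linarith
  then show abs: "\<bar>inner d (tangent \<phi>)\<bar> < 1"
    by (simp add: abs_square_less_1)
  then show "arccos (inner d (tangent \<phi>)) \<in> {0<..<pi}"
    using arccos_lt_bounded by auto
  have "inner d (normal \<phi>) = sqrt (1 - (inner d (tangent \<phi>))\<^sup>2)"
    using eq assms(2) by (intro real_sqrt_unique[symmetric]) auto
  then show "direction \<phi> (arccos (inner d (tangent \<phi>))) = d"
    using abs frame_expansion[of d \<phi>] by (simp add: direction_def sin_arccos_abs)
qed

context
  fixes \<Gamma> :: "real \<Rightarrow> complex"
  assumes oval: "oval \<Gamma>"
begin

lemma oval_chord_nonzero:
  assumes "cis \<phi> \<noteq> cis \<psi>"
  shows "\<Gamma> \<psi> - \<Gamma> \<phi> \<noteq> 0"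
  using oval_strictly_convex[OF oval, of \<psi> \<phi>] assms by auto

lemma chord_dir_oval:
  assumes "cis \<phi> \<noteq> cis \<psi>"
  shows "norm (chord_dir \<Gamma> (\<phi>, \<psi>)) = 1"
    and "\<Gamma> \<psi> = \<Gamma> \<phi> + norm (\<Gamma> \<psi> - \<Gamma> \<phi>) *\<^sub>R chord_dir \<Gamma> (\<phi>, \<psi>)"
    and "inner (chord_dir \<Gamma> (\<phi>, \<psi>)) (normal \<phi>) > 0"
    and "inner (chord_dir \<Gamma> (\<phi>, \<psi>)) (normal \<psi>) < 0"
proof -
  have pos: "norm (\<Gamma> \<psi> - \<Gamma> \<phi>) > 0"
    using oval_chord_nonzero[OF assms] by simp
  then show "norm (chord_dir \<Gamma> (\<phi>, \<psi>)) = 1"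
    "\<Gamma> \<psi> = \<Gamma> \<phi> + norm (\<Gamma> \<psi> - \<Gamma> \<phi>) *\<^sub>R chord_dir \<Gamma> (\<phi>, \<psi>)"
    by (simp_all add: chord_dir_def)
  show "inner (chord_dir \<Gamma> (\<phi>, \<psi>)) (normal \<phi>) > 0"
    using oval_strictly_convex[OF oval, of \<psi> \<phi>] assms pos by (simp add: chord_dir_def)
  have "inner (\<Gamma> \<psi> - \<Gamma> \<phi>) (normal \<psi>) < 0"
    using oval_strictly_convex[OF oval assms] by (simp add: inner_diff_left)
  then show "inner (chord_dir \<Gamma> (\<phi>, \<psi>)) (normal \<psi>) < 0"
    using pos by (simp add: chord_dir_def mult_pos_neg)
qed

lemma next_collision_chord:
  assumes "cis \<phi> \<noteq> cis \<psi>"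
  shows "next_collision \<Gamma> (phase (chord_start \<Gamma> (\<phi>, \<psi>))) (phase (chord_end \<Gamma> (\<phi>, \<psi>)))"
proof -
  define d where "d = chord_dir \<Gamma> (\<phi>, \<psi>)"
  \<comment> \<open>The reflected direction; it points inward because the chord arrives with
    negative normal component.\<close>
  define e where "e = d - (2 * inner d (normal \<psi>)) *\<^sub>R normal \<psi>"
  note chord = chord_dir_oval[OF assms, folded d_def]
  have e: "inner e (tangent \<psi>) = inner d (tangent \<psi>)" "inner e (normal \<psi>) = - inner d (normal \<psi>)"
    by (simp_all add: e_def inner_diff_left inner_frame)
  then have "(norm e)\<^sup>2 = (norm d)\<^sup>2"
    by (simp add: norm_frame_expansion[of _ \<psi>])
  then have "norm e = norm d" by (rule power2_eq_imp_eq) simp_all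
  then have "norm e = 1" using chord(1) by simp
  note de = direction_arccos[OF chord(1,3)] direction_arccos[of e \<psi>, OF this]
  have "cos (arccos (inner d (tangent \<phi>))) = inner d (tangent \<phi>)"
    "cos (arccos (inner d (tangent \<psi>))) = inner d (tangent \<psi>)"
    using de(3,6) chord(4) by (auto intro!: cos_arccos_abs simp: e)
  moreover have "direction \<psi> (arccos (inner d (tangent \<psi>))) = e"
    "arccos (inner d (tangent \<psi>)) \<in> {0<..<pi}"
    using de(4,5) chord(4) by (simp_all add: e)
  moreover have "norm (\<Gamma> \<psi> - \<Gamma> \<phi>) > 0"
    using oval_chord_nonzero[OF assms] by simp
  ultimately show ?thesis
    unfolding next_collision_def chord_start_def chord_end_def d_def[symmetric] fst_conv snd_conv Let_def
    using de(1,2) chord(2)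
    by (intro exI[of _ \<phi>] exI[of _ "arccos (inner d (tangent \<phi>))"] exI[of _ \<psi>]
        exI[of _ "arccos (inner d (tangent \<psi>))"] exI[of _ "norm (\<Gamma> \<psi> - \<Gamma> \<phi>)"] conjI)
      (simp_all only: e_def)
qed

text \<open>Were there two further impacts, the supporting line at the nearer one would have the
  farther one strictly on its inner side; the ray would then cross that line inward, leaving its
  origin z, a point of the curve, on the outer side.\<close>

lemma oval_ray_unique:
  assumes "\<Gamma> \<psi> = z + t *\<^sub>R d" "\<Gamma> \<psi>' = z + t' *\<^sub>R d" "\<Gamma> \<phi> = z" "t > 0" "t' > 0"
  shows "cis \<psi> = cis \<psi>'"
  using assms
proof (induction t t' arbitrary: \<psi> \<psi>' rule: linorder_wlog)
  case (le t t')
  show ?case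
  proof (rule ccontr)
    assume "cis \<psi> \<noteq> cis \<psi>'"
    then have "inner (\<Gamma> \<psi>' - \<Gamma> \<psi>) (normal \<psi>) > 0"
      using oval_strictly_convex[OF oval] by metis
    also have "\<Gamma> \<psi>' - \<Gamma> \<psi> = (t' - t) *\<^sub>R d"
      using le by (simp add: algebra_simps)
    finally have "inner d (normal \<psi>) > 0"
      using le by (simp add: zero_less_mult_iff)
    moreover have "inner (\<Gamma> \<phi> - \<Gamma> \<psi>) (normal \<psi>) = - (t * inner d (normal \<psi>))"
      using le by simp
    ultimately show False
      using oval_convex[OF oval, of \<phi> \<psi>] le by (simp add: mult_le_0_iff)
  qed
next
  case (sym t t')
  show ?case
    by (rule sym(1)[OF sym(3,2,4,6,5), symmetric])
qed

text \<open>\<open>next_collision\<close> leaves the angle representatives open. Pinning the start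
  to the given \<phi> and to \<open>arccos p\<close> puts any two collisions from one phase point on
  the same ray.\<close>

lemma next_collisionD:
  assumes "next_collision \<Gamma> (phase (\<phi>, p)) y"
  obtains \<psi> t where "t > 0" "\<Gamma> \<psi> = \<Gamma> \<phi> + t *\<^sub>R direction \<phi> (arccos p)"
    "y = phase (\<psi>, inner (direction \<phi> (arccos p)) (tangent \<psi>))"
proof -
  obtain \<phi>' \<alpha> \<psi> \<beta> t where *: "phase (\<phi>, p) = phase (\<phi>', cos \<alpha>)" "\<alpha> \<in> {0<..<pi}"
    "y = phase (\<psi>, cos \<beta>)" "t > 0" "\<Gamma> \<psi> = \<Gamma> \<phi>' + t *\<^sub>R direction \<phi>' \<alpha>"
    "direction \<psi> \<beta> = direction \<phi>' \<alpha> - (2 * inner (direction \<phi>' \<alpha>) (normal \<psi>)) *\<^sub>R normal \<psi>"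
    using assms unfolding next_collision_def Let_def by blast
  then have \<phi>: "cis \<phi>' = cis \<phi>" "p = cos \<alpha>" by (auto simp: phase_def)
  then have "arccos p = \<alpha>" "direction \<phi>' = direction \<phi>" "\<Gamma> \<phi>' = \<Gamma> \<phi>"
    using *(2) by (auto simp: arccos_cos intro: direction_cong oval_cong[OF oval])
  moreover have "cos \<beta> = inner (direction \<phi>' \<alpha>) (tangent \<psi>)"
    using inner_direction_tangent[of \<psi> \<beta>] by (simp add: *(6) inner_diff_left inner_frame)
  ultimately show ?thesis using *(3-5) by (intro that[of t \<psi>]) simp_all
qed

lemma next_collision_unique:
  assumes "next_collision \<Gamma> (phase x) y" "next_collision \<Gamma> (phase x) y'"
  shows "y = y'"
proof -
  obtain \<phi> p where x: "x = (\<phi>, p)" by fastforce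
  let ?d = "direction \<phi> (arccos p)"
  obtain \<psi> t where y: "t > 0" "\<Gamma> \<psi> = \<Gamma> \<phi> + t *\<^sub>R ?d" "y = phase (\<psi>, inner ?d (tangent \<psi>))"
    by (rule next_collisionD[OF assms(1)[unfolded x]])
  obtain \<psi>' t' where y': "t' > 0" "\<Gamma> \<psi>' = \<Gamma> \<phi> + t' *\<^sub>R ?d" "y' = phase (\<psi>', inner ?d (tangent \<psi>'))"
    by (rule next_collisionD[OF assms(2)[unfolded x]])
  have "cis \<psi> = cis \<psi>'"
    by (rule oval_ray_unique[OF y(2) y'(2) refl y(1) y'(1)])
  then show ?thesis using y(3) y'(3) by (simp add: phase_def tangent_def)
qed

lemma billiard_map_chord:
  assumes "cis \<phi> \<noteq> cis \<psi>"
  shows "billiard_map \<Gamma> (phase (chord_start \<Gamma> (\<phi>, \<psi>))) = phase (chord_end \<Gamma> (\<phi>, \<psi>))"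
  unfolding billiard_map_def
proof (rule the_equality)
  show collision: "next_collision \<Gamma> (phase (chord_start \<Gamma> (\<phi>, \<psi>))) (phase (chord_end \<Gamma> (\<phi>, \<psi>)))"
    by (rule next_collision_chord[OF assms])
  show "y = phase (chord_end \<Gamma> (\<phi>, \<psi>))"
    if "next_collision \<Gamma> (phase (chord_start \<Gamma> (\<phi>, \<psi>))) y" for y
    by (rule next_collision_unique[OF that collision])
qed

lemma phase_chord_in_phase_space:
  assumes "cis \<phi> \<noteq> cis \<psi>"
  shows "phase (chord_start \<Gamma> (\<phi>, \<psi>)) \<in> phase_space" "phase (chord_end \<Gamma> (\<phi>, \<psi>)) \<in> phase_space"
proof -
  note d = chord_dir_oval[OF assms]
  have "\<bar>inner (- chord_dir \<Gamma> (\<phi>, \<psi>)) (tangent \<psi>)\<bar> < 1"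
    by (rule direction_arccos(3)) (use d in auto)
  then show "phase (chord_start \<Gamma> (\<phi>, \<psi>)) \<in> phase_space" "phase (chord_end \<Gamma> (\<phi>, \<psi>)) \<in> phase_space"
    using direction_arccos(3)[OF d(1,3)]
    by (auto simp: phase_def phase_space_def chord_start_def chord_end_def)
qed

text \<open>Determinism of the billiard: equal starts have equal next impacts, so the end angles
  agree modulo 2 \<pi>, and the open window of length 2 \<pi> after \<phi> leaves room for one
  representative only.\<close>

lemma inj_on_chord_start:
  "inj_on (chord_start \<Gamma>) {w. fst w < snd w \<and> snd w < fst w + 2 * pi}"
proof (rule inj_onI, clarsimp)
  fix \<phi> \<psi> \<phi>' \<psi>'
  assume *: "\<phi> < \<psi>" "\<psi> < \<phi> + 2 * pi" "\<phi>' < \<psi>'" "\<psi>' < \<phi>' + 2 * pi"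
    "chord_start \<Gamma> (\<phi>, \<psi>) = chord_start \<Gamma> (\<phi>', \<psi>')"
  then have "\<phi> = \<phi>'" by (simp add: chord_start_def)
  have "phase (chord_end \<Gamma> (\<phi>, \<psi>)) = phase (chord_end \<Gamma> (\<phi>', \<psi>'))"
    using billiard_map_chord cis_distinct * by metis
  then have "cis \<psi> = cis \<psi>'" by (simp add: chord_end_def phase_def)
  then have "\<psi> = \<psi>'"
    using cis_distinct[of \<psi> \<psi>'] cis_distinct[of \<psi>' \<psi>] * \<open>\<phi> = \<phi>'\<close> by force
  then show "\<phi> = \<phi>' \<and> \<psi> = \<psi>'" using \<open>\<phi> = \<phi>'\<close> by simp
qed

end

lemma chord_shift:
  assumes "\<Gamma> \<in> sym_ovals n"
  defines "\<theta> j \<equiv> of_int j * (2 * pi / real n)"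
  shows "chord_start \<Gamma> (\<phi> + \<theta> j, \<psi> + \<theta> j) = chord_start \<Gamma> (\<phi>, \<psi>) + (\<theta> j, 0)"
    and "chord_end \<Gamma> (\<phi> + \<theta> j, \<psi> + \<theta> j) = chord_end \<Gamma> (\<phi>, \<psi>) + (\<theta> j, 0)"
proof -
  have "\<Gamma> (x + \<theta> j) = cis (\<theta> j) * \<Gamma> x" for x
    using sym_oval_rotate_int[OF assms(1)] by (simp add: \<theta>_def)
  then have "\<Gamma> (\<psi> + \<theta> j) - \<Gamma> (\<phi> + \<theta> j) = cis (\<theta> j) * (\<Gamma> \<psi> - \<Gamma> \<phi>)"
    by (simp add: right_diff_distrib)
  then have "chord_dir \<Gamma> (\<phi> + \<theta> j, \<psi> + \<theta> j) = cis (\<theta> j) * chord_dir \<Gamma> (\<phi>, \<psi>)"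
    by (simp only: chord_dir_def fst_conv snd_conv norm_mult norm_cis mult_1_left mult_scaleR_right)
  then show "chord_start \<Gamma> (\<phi> + \<theta> j, \<psi> + \<theta> j) = chord_start \<Gamma> (\<phi>, \<psi>) + (\<theta> j, 0)"
    "chord_end \<Gamma> (\<phi> + \<theta> j, \<psi> + \<theta> j) = chord_end \<Gamma> (\<phi>, \<psi>) + (\<theta> j, 0)"
    by (simp_all add: chord_start_def chord_end_def frame_rotate inner_mult_unit)
qed

section \<open>Rotation classes, quotient maps and their local lifts\<close>

lemma phase_shift: "phase (x + (a, 0)) = (cis a * fst (phase x), snd (phase x))"
  by (cases x) (simp add: phase_def cis_mult add.commute)

text \<open>The generating relation is a single rotation step; closing it under symmetry supplies
  the negative powers.\<close>

lemma equivclp_phase_rot: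
  "equivclp (\<lambda>a b. b = phase_rot n m a) x y \<longleftrightarrow>
     (\<exists>j::int. y = (cis (of_int j * (2 * real m * pi / real n)) * fst x, snd x))"
  (is "equivclp ?r x y \<longleftrightarrow> (\<exists>j. y = ?shift j x)")
proof
  have rot: "phase_rot n m z = ?shift 1 z" for z
    by (cases z) (simp add: phase_rot_def)
  have add: "?shift i (?shift j z) = ?shift (i + j) z" for i j z
    by (simp add: cis_mult mult.assoc[symmetric] ring_distribs add_divide_distrib)
  show "\<exists>j. y = ?shift j x" if "equivclp ?r x y"
    using that
  proof (induction rule: equivclp_induct)
    case base
    show ?case by (rule exI[of _ 0]) simp
  next
    case (step y z)
    then obtain j where j: "y = ?shift j x" by blast
    from step(2) show ?case
    proof
      assume "z = phase_rot n m y"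
      then show ?thesis unfolding rot j add by blast
    next
      assume "y = phase_rot n m z"
      moreover have "?shift (-1) (?shift 1 z) = z" unfolding add by simp
      ultimately have "z = ?shift (-1) y" unfolding rot by metis
      then show ?thesis unfolding j add by blast
    qed
  qed
  have "equivclp ?r x (?shift j x)" for j
  proof (induction j rule: int_induct[of _ 0])
    case (step1 i)
    have "?r (?shift i x) (?shift (i + 1) x)" unfolding rot add by (simp only: add.commute)
    then show ?case using equivclp_into_equivclp[OF step1(2)] by blast
  next
    case (step2 i)
    have "?r (?shift (i - 1) x) (?shift i x)" unfolding rot add by simp
    then show ?case using equivclp_into_equivclp[OF step2(2)] by blast
  qed simp
  then show "equivclp ?r x y" if "\<exists>j. y = ?shift j x" using that by blast
qed

lemma quot_rel_iff:
  "(x, y) \<in> quot_rel n m \<longleftrightarrow> x \<in> phase_space \<and>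
     (\<exists>j::int. y = (cis (of_int j * (2 * real m * pi / real n)) * fst x, snd x))"
  by (auto simp: quot_rel_def equivclp_phase_rot phase_space_def norm_mult)

lemma equiv_quot_rel: "equiv phase_space (quot_rel n m)"
proof (rule equivI)
  show "refl_on phase_space (quot_rel n m)"
    by (auto simp: refl_on_def quot_rel_def)
  show "sym (quot_rel n m)" "trans (quot_rel n m)"
    by (auto simp: sym_def trans_def quot_rel_def intro: equivclp_sym equivclp_trans)
  show "quot_rel n m \<subseteq> phase_space \<times> phase_space"
    by (auto simp: quot_rel_def)
qed

lemma quot_pt_shift:
  assumes "phase x \<in> phase_space"
  shows "quot_pt n m (x + (of_int j * (2 * real m * pi / real n), 0)) = quot_pt n m x"
proof -
  have "(phase x, phase (x + (of_int j * (2 * real m * pi / real n), 0))) \<in> quot_rel n m"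
    using assms by (auto simp: quot_rel_iff phase_shift)
  then show ?thesis
    unfolding quot_pt_def using equiv_class_eq[OF equiv_quot_rel] by blast
qed

text \<open>Rotating the start of a chord rotates its end by the same angle, so
  \<open>billiard_map\<close> sends a whole class into one class, and the union of image classes
  that \<open>quot_map\<close> forms collapses to the class of the chord end.\<close>

lemma quot_map_chord:
  assumes sym: "\<Gamma> \<in> sym_ovals n" and distinct: "cis \<phi> \<noteq> cis \<psi>"
  shows "quot_map n m \<Gamma> (quot_pt n m (chord_start \<Gamma> (\<phi>, \<psi>))) = quot_pt n m (chord_end \<Gamma> (\<phi>, \<psi>))"
proof -
  let ?s = "phase (chord_start \<Gamma> (\<phi>, \<psi>))" and ?e = "phase (chord_end \<Gamma> (\<phi>, \<psi>))"
  note oval = sym_oval[OF sym]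
  note space = phase_chord_in_phase_space[OF oval distinct]
  have image: "(?e, billiard_map \<Gamma> y) \<in> quot_rel n m" if related: "(?s, y) \<in> quot_rel n m" for y
  proof -
    obtain j :: int where "y = (cis (of_int j * (2 * real m * pi / real n)) * fst ?s, snd ?s)"
      using related unfolding quot_rel_iff by blast
    moreover define \<theta> where "\<theta> = of_int j * (2 * real m * pi / real n)"
    ultimately have "y = phase (chord_start \<Gamma> (\<phi>, \<psi>) + (\<theta>, 0))"
      by (simp add: phase_shift)
    moreover have \<theta>: "\<theta> = of_int (j * int m) * (2 * pi / real n)" by (simp add: \<theta>_def)
    note shift = chord_shift[OF sym, of \<phi> "j * int m" \<psi>, folded \<theta>]
    ultimately have "y = phase (chord_start \<Gamma> (\<phi> + \<theta>, \<psi> + \<theta>))"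
      by (simp only: shift)
    moreover have "cis (\<phi> + \<theta>) \<noteq> cis (\<psi> + \<theta>)"
      using distinct by (simp add: cis_mult[symmetric])
    ultimately have "billiard_map \<Gamma> y = phase (chord_end \<Gamma> (\<phi> + \<theta>, \<psi> + \<theta>))"
      using billiard_map_chord[OF oval] by simp
    also have "\<dots> = phase (chord_end \<Gamma> (\<phi>, \<psi>) + (\<theta>, 0))"
      by (simp only: shift)
    finally show ?thesis using space by (auto simp: quot_rel_iff phase_shift \<theta>_def)
  qed
  have "(?s, ?s) \<in> quot_rel n m"
    using equiv_class_self[OF equiv_quot_rel space(1)] by simp
  then have nonempty: "quot_rel n m `` {?s} \<noteq> {}" by blast
  have "quot_rel n m `` {billiard_map \<Gamma> y} = quot_rel n m `` {?e}" if "y \<in> quot_rel n m `` {?s}" for y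
    using equiv_class_eq[OF equiv_quot_rel image] that by simp
  then have "(\<Union>y\<in>quot_rel n m `` {?s}. quot_rel n m `` {billiard_map \<Gamma> y}) = quot_rel n m `` {?e}"
    using nonempty by simp
  moreover have "quot_rel n m `` (billiard_map \<Gamma> ` (quot_rel n m `` {?s})) =
      (\<Union>y\<in>quot_rel n m `` {?s}. quot_rel n m `` {billiard_map \<Gamma> y})"
    by blast
  ultimately have "quot_rel n m `` (billiard_map \<Gamma> ` (quot_rel n m `` {?s})) = quot_rel n m `` {?e}"
    by simp
  then show ?thesis by (simp add: quot_map_def quot_pt_def)
qed

text \<open>Near z both lifts are close to z, while their angles can differ only by an element of
  the discrete group generated by 2 \<pi> / n; so the lifts agree on a neighbourhood.\<close>

lemma has_quot_derivative_unique:
  assumes "n > 0" "\<bar>snd z\<bar> < 1"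
    and "has_quot_derivative n m \<Gamma> z D" "has_quot_derivative n m \<Gamma> z D'"
  shows "D = D'"
proof -
  obtain F where F: "F z = z"
      "\<forall>\<^sub>F w in nhds z. quot_pt n m (F w) = quot_map n m \<Gamma> (quot_pt n m w)"
      "(F has_derivative D) (at z)"
    using assms(3) by (auto simp: has_quot_derivative_def)
  obtain G where G: "G z = z"
      "\<forall>\<^sub>F w in nhds z. quot_pt n m (G w) = quot_map n m \<Gamma> (quot_pt n m w)"
      "(G has_derivative D') (at z)"
    using assms(4) by (auto simp: has_quot_derivative_def)
  have "(F \<longlongrightarrow> F z) (nhds z)" "(G \<longlongrightarrow> G z) (nhds z)"
    using has_derivative_continuous[OF F(3)] has_derivative_continuous[OF G(3)]
    unfolding continuous_at tendsto_at_iff_tendsto_nhds .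
  then have lim: "(F \<longlongrightarrow> z) (nhds z)" "(G \<longlongrightarrow> z) (nhds z)"
    using F(1) G(1) by simp_all
  have "\<forall>\<^sub>F w in nhds z. \<bar>snd (F w)\<bar> < 1"
    using order_tendstoD(2)[OF tendsto_rabs[OF tendsto_snd[OF lim(1)]] assms(2)] .
  moreover have "((\<lambda>w. \<bar>fst (F w) - fst (G w)\<bar>) \<longlongrightarrow> \<bar>fst z - fst z\<bar>) (nhds z)"
    by (intro tendsto_intros lim)
  then have "\<forall>\<^sub>F w in nhds z. \<bar>fst (F w) - fst (G w)\<bar> < 2 * pi / n"
    by (rule order_tendstoD(2)) (use assms in simp)
  ultimately have "\<forall>\<^sub>F w in nhds z. F w = G w"
    using F(2) G(2)
  proof eventually_elim
    case (elim w)
    obtain x p y q where w: "F w = (x, p)" "G w = (y, q)" by fastforce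
    have "phase (F w) \<in> phase_space"
      using elim(1) w by (auto simp: phase_def phase_space_def)
    then have "phase (F w) \<in> quot_pt n m (F w)"
      unfolding quot_pt_def using equiv_class_self[OF equiv_quot_rel] by blast
    then have "phase (F w) \<in> quot_pt n m (G w)"
      using elim(3,4) by simp
    then have "(phase (G w), phase (F w)) \<in> quot_rel n m"
      by (simp add: quot_pt_def)
    then obtain j :: int where "p = q" and "cis x = cis (of_int j * (2 * real m * pi / real n)) * cis y"
      using w by (auto simp: quot_rel_iff phase_def)
    then have "cis x = cis (of_int j * (2 * real m * pi / real n) + y)" by (simp add: cis_mult)
    then obtain i :: int where i: "x = of_int j * (2 * real m * pi / real n) + y + of_int i * (2 * pi)"
      by (rule cis_eq_imp_shift)
    \<comment> \<open>Rotations identified by the quotient and full turns are both multiples of 2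
      \<pi> / n; \<open>l\<close> counts them together.\<close>
    define l where "l = j * int m + i * int n"
    have "x - y = of_int l * (2 * pi / n)"
      using assms(1) by (simp add: i l_def field_simps)
    moreover have "\<bar>x - y\<bar> < 2 * pi / n" using elim w by simp
    ultimately have "\<bar>of_int l\<bar> * (2 * pi / n) < 1 * (2 * pi / n)"
      by (simp add: abs_mult)
    then have "l = 0" unfolding mult_less_cancel_right using assms(1) by (auto simp: mult_less_0_iff zero_less_divide_iff)
    then show ?case using \<open>x - y = _\<close> \<open>p = q\<close> w by simp
  qed
  then have "(G has_derivative D) (at z)"
    using F(1,3) G(1) has_derivative_transform_eventually[OF F(3), of G]
    by (simp add: eventually_nhds_conv_at)
  then show ?thesis using G(3) by (rule has_derivative_unique)
qed


section \<open>The derivative at a symmetric orbit\<close>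


lemma has_derivative_oval_chord:
  assumes "oval \<Gamma>"
  defines "R \<equiv> curvature_radius \<Gamma>"
  shows "((\<lambda>w. \<Gamma> (snd w) - \<Gamma> (fst w)) has_derivative
    (\<lambda>h. (snd h * R \<psi>) *\<^sub>R tangent \<psi> - (fst h * R \<phi>) *\<^sub>R tangent \<phi>)) (at (\<phi>, \<psi>))"
proof -
  have "(\<Gamma> has_derivative (\<lambda>h. h *\<^sub>R R x *\<^sub>R tangent x)) (at x)" for x
    using oval_derivative[OF assms(1)] by (simp add: has_vector_derivative_def R_def)
  from has_derivative_diff[OF has_derivative_compose[OF has_derivative_snd[OF has_derivative_ident] this]
      has_derivative_compose[OF has_derivative_fst[OF has_derivative_ident] this]]
  show ?thesis by fastforce
qed

lemma has_derivative_tangent_comp: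
  assumes "(f has_derivative f') (at w)"
  shows "((\<lambda>w. tangent (f w)) has_derivative (\<lambda>h. f' h *\<^sub>R normal (f w))) (at w)"
  using has_derivative_compose[OF assms has_vector_derivative_frame(1)[unfolded has_vector_derivative_def]] .

text \<open>The derivative of a normalized vector D / |D| is the part of D' orthogonal to u, divided
  by |D|; this explains the differences of inner products. The last summand comes from the turning
  of the tangent. Taking f to be \<open>fst\<close> or \<open>snd\<close> serves either end of the
  chord.\<close>

lemma has_derivative_chord_component:
  assumes "oval \<Gamma>" "cis \<phi> \<noteq> cis \<psi>" "(f has_derivative f') (at (\<phi>, \<psi>))"
  defines "R \<equiv> curvature_radius \<Gamma>" and "L \<equiv> norm (\<Gamma> \<psi> - \<Gamma> \<phi>)"
    and "u \<equiv> chord_dir \<Gamma> (\<phi>, \<psi>)" and "\<tau> \<equiv> tangent (f (\<phi>, \<psi>))" and "\<nu> \<equiv> normal (f (\<phi>, \<psi>))"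
  shows "((\<lambda>w. inner (chord_dir \<Gamma> w) (tangent (f w))) has_derivative
    (\<lambda>h. snd h * (R \<psi> / L * (inner (tangent \<psi>) \<tau> - inner u (tangent \<psi>) * inner u \<tau>)) -
         fst h * (R \<phi> / L * (inner (tangent \<phi>) \<tau> - inner u (tangent \<phi>) * inner u \<tau>)) +
         f' h * inner u \<nu>)) (at (\<phi>, \<psi>))"
proof -
  let ?D = "\<lambda>w. \<Gamma> (snd w) - \<Gamma> (fst w)"
  let ?D' = "\<lambda>h. (snd h * R \<psi>) *\<^sub>R tangent \<psi> - (fst h * R \<phi>) *\<^sub>R tangent \<phi>"
  have D: "(?D has_derivative ?D') (at (\<phi>, \<psi>))"
    using has_derivative_oval_chord[OF assms(1)] by (simp add: R_def)
  have L: "L > 0" using oval_chord_nonzero[OF assms(1,2)] by (simp add: L_def)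
  have u: "u = ?D (\<phi>, \<psi>) /\<^sub>R L" by (simp add: u_def chord_dir_def L_def)
  have "((\<lambda>w. norm (?D w)) has_derivative (\<lambda>h. inner u (?D' h))) (at (\<phi>, \<psi>))"
    using has_derivative_compose[OF D has_derivative_norm[of "?D (\<phi>, \<psi>)"]] L
    by (simp add: u L_def sgn_div_norm inner_commute)
  from has_derivative_divide'[OF has_derivative_inner[OF D has_derivative_tangent_comp[OF assms(3)]] this]
  have "((\<lambda>w. inner (?D w) (tangent (f w)) / norm (?D w)) has_derivative
    (\<lambda>h. ((inner (?D (\<phi>, \<psi>)) (f' h *\<^sub>R \<nu>) + inner (?D' h) \<tau>) * L -
      inner (?D (\<phi>, \<psi>)) \<tau> * inner u (?D' h)) / (L * L))) (at (\<phi>, \<psi>))"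
    using L by (simp add: L_def \<nu>_def \<tau>_def)
  moreover have "?D (\<phi>, \<psi>) = L *\<^sub>R u" using L by (simp add: u)
  ultimately have "((\<lambda>w. inner (?D w) (tangent (f w)) / norm (?D w)) has_derivative
    (\<lambda>h. ((L * inner u (f' h *\<^sub>R \<nu>) + inner (?D' h) \<tau>) * L -
      L * inner u \<tau> * inner u (?D' h)) / (L * L))) (at (\<phi>, \<psi>))"
    by (simp add: mult.left_commute)
  moreover have "((L * inner u (f' h *\<^sub>R \<nu>) + inner (?D' h) \<tau>) * L -
      L * inner u \<tau> * inner u (?D' h)) / (L * L) =
    snd h * (R \<psi> / L * (inner (tangent \<psi>) \<tau> - inner u (tangent \<psi>) * inner u \<tau>)) -
         fst h * (R \<phi> / L * (inner (tangent \<phi>) \<tau> - inner u (tangent \<phi>) * inner u \<tau>)) +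
         f' h * inner u \<nu>" for h
    using L by (simp add: inner_diff_left inner_diff_right field_simps)
  ultimately show ?thesis
    by (simp add: chord_dir_def[abs_def] divide_inverse mult.commute)
qed

text \<open>At a critical point of the support function the tangent is orthogonal to the position
  vector, so the chord joining it to its rotated copy makes the angle \<open>\<alpha>\<close> with both tangents.\<close>

lemma symmetric_chord:
  fixes n m :: nat and \<phi> :: real
  assumes sym: "\<Gamma> \<in> sym_ovals n" and "1 \<le> m" "m < n" and crit: "nderiv (Suc 0) (support_fun \<Gamma>) \<phi> = 0"
  defines "\<alpha> \<equiv> m * pi / n"
  shows "cis \<phi> \<noteq> cis (\<phi> + 2 * \<alpha>)" "sin \<alpha> > 0"
    and "norm (\<Gamma> (\<phi> + 2 * \<alpha>) - \<Gamma> \<phi>) = 2 * support_fun \<Gamma> \<phi> * sin \<alpha>"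
    and "chord_dir \<Gamma> (\<phi>, \<phi> + 2 * \<alpha>) = tangent (\<phi> + \<alpha>)"
    and "curvature_radius \<Gamma> (\<phi> + 2 * \<alpha>) = curvature_radius \<Gamma> \<phi>"
proof -
  let ?g = "support_fun \<Gamma>"
  note oval = sym_oval[OF sym]
  have \<alpha>: "0 < \<alpha>" "\<alpha> < pi" and shift: "2 * \<alpha> = of_int (int m) * (2 * pi / n)"
    using assms by (auto simp: \<alpha>_def field_simps)
  then show s: "sin \<alpha> > 0" by (simp add: sin_gt_zero)
  have g: "?g \<phi> > 0" using support_fun_pos[OF sym] assms by simp
  have per: "periodic (2 * pi / n) ?g" "C_infinity ?g"
    using support_fun_periodic[OF sym] C_infinity_support_fun[OF oval] .
  have shift_per: "nderiv k ?g (\<phi> + 2 * \<alpha>) = nderiv k ?g \<phi>" for k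
    unfolding shift by (rule periodic_int[OF periodic_nderiv[OF per(2,1)]])
  then show "curvature_radius \<Gamma> (\<phi> + 2 * \<alpha>) = curvature_radius \<Gamma> \<phi>"
    using shift_per[of 0] by (simp add: curvature_radius_def)
  have "\<Gamma> x = - ?g \<phi> *\<^sub>R normal x" if "x = \<phi> \<or> x = \<phi> + 2 * \<alpha>" for x
    using that oval_eq_support[OF oval, of x] crit shift_per[of 0] shift_per[of "Suc 0"] by auto
  then have "\<Gamma> (\<phi> + 2 * \<alpha>) - \<Gamma> \<phi> = ?g \<phi> *\<^sub>R (normal \<phi> - normal (\<phi> + 2 * \<alpha>))"
    by (simp add: algebra_simps)
  also have "normal \<phi> - normal (\<phi> + 2 * \<alpha>) = (2 * sin \<alpha>) *\<^sub>R tangent (\<phi> + \<alpha>)"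
  proof -
    have "normal (b - \<alpha>) - normal (b + \<alpha>) = (2 * sin \<alpha>) *\<^sub>R tangent b" for b
      by (simp add: complex_eq_iff normal_def tangent_def sin_add sin_diff cos_add cos_diff)
    from this[of "\<phi> + \<alpha>"] show ?thesis by (simp add: add.assoc)
  qed
  finally have chord: "\<Gamma> (\<phi> + 2 * \<alpha>) - \<Gamma> \<phi> = (2 * ?g \<phi> * sin \<alpha>) *\<^sub>R tangent (\<phi> + \<alpha>)"
    by simp
  then show len: "norm (\<Gamma> (\<phi> + 2 * \<alpha>) - \<Gamma> \<phi>) = 2 * ?g \<phi> * sin \<alpha>"
    using g s by simp
  then show "chord_dir \<Gamma> (\<phi>, \<phi> + 2 * \<alpha>) = tangent (\<phi> + \<alpha>)"
    unfolding chord_dir_def fst_conv snd_conv chord using g s by (simp add: abs_mult field_simps)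
  show "cis \<phi> \<noteq> cis (\<phi> + 2 * \<alpha>)"
  proof
    assume "cis \<phi> = cis (\<phi> + 2 * \<alpha>)"
    from oval_cong[OF oval this] show False using len g s by simp
  qed
qed

text \<open>Here R / L = \<rho> / s, and the differences of inner products in
  \<open>has_derivative_chord_component\<close> reduce to s * s when both tangents belong to the
  same end and to - s * s for opposite ends; the turning of the tangent adds s at the start and - s
  at the end.\<close>

lemma symmetric_chord_derivatives:
  fixes n m :: nat and \<phi> :: real
  assumes sym: "\<Gamma> \<in> sym_ovals n" and m: "1 \<le> m" "m < n"
    and crit: "nderiv (Suc 0) (support_fun \<Gamma>) \<phi> = 0"
  defines "\<alpha> \<equiv> m * pi / n"
  defines "s \<equiv> sin \<alpha>" and "\<rho> \<equiv> curvature_radius \<Gamma> \<phi> / (2 * support_fun \<Gamma> \<phi>)"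
  shows "(chord_start \<Gamma> has_derivative (\<lambda>h. (fst h, s * (1 - \<rho>) * fst h - s * \<rho> * snd h)))
      (at (\<phi>, \<phi> + 2 * \<alpha>))"
    and "(chord_end \<Gamma> has_derivative (\<lambda>h. (snd h, s * \<rho> * fst h - s * (1 - \<rho>) * snd h)))
      (at (\<phi>, \<phi> + 2 * \<alpha>))"
proof -
  let ?w = "(\<phi>, \<phi> + 2 * \<alpha>)"
  note oval = sym_oval[OF sym]
  note chord = symmetric_chord[OF sym m crit, folded \<alpha>_def, folded s_def]
  have g: "support_fun \<Gamma> \<phi> > 0" using support_fun_pos[OF sym] m by simp
  have frame: "inner (tangent (\<phi> + \<alpha>)) (tangent \<phi>) = cos \<alpha>"
    "inner (tangent (\<phi> + \<alpha>)) (normal \<phi>) = s"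
    "inner (tangent (\<phi> + \<alpha>)) (tangent (\<phi> + 2 * \<alpha>)) = cos \<alpha>"
    "inner (tangent (\<phi> + \<alpha>)) (normal (\<phi> + 2 * \<alpha>)) = - s"
    "inner (tangent (\<phi> + 2 * \<alpha>)) (tangent \<phi>) = 1 - 2 * s * s"
    "inner (tangent \<phi>) (tangent (\<phi> + 2 * \<alpha>)) = 1 - 2 * s * s"
    "inner (tangent x) (tangent x) = 1" "cos \<alpha> * cos \<alpha> = 1 - s * s" for x
    using sin_cos_squared_add[of \<alpha>] cos_double_sin[of \<alpha>] cos_minus[of "2 * \<alpha>"]
    by (simp_all add: inner_frame s_def power2_eq_square)
  have "((\<lambda>w. inner (chord_dir \<Gamma> w) (tangent (fst w))) has_derivative
      (\<lambda>h. s * (1 - \<rho>) * fst h - s * \<rho> * snd h)) (at ?w)"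
    using has_derivative_chord_component[OF oval chord(1) has_derivative_fst[OF has_derivative_ident]]
    unfolding chord fst_conv snd_conv frame
    by (rule has_derivative_eq_rhs) (use chord(2) g in \<open>simp add: fun_eq_iff \<rho>_def field_simps\<close>)
  from has_derivative_Pair[OF has_derivative_fst[OF has_derivative_ident] this]
  show "(chord_start \<Gamma> has_derivative (\<lambda>h. (fst h, s * (1 - \<rho>) * fst h - s * \<rho> * snd h))) (at ?w)"
    by (simp add: chord_start_def[abs_def])
  have "((\<lambda>w. inner (chord_dir \<Gamma> w) (tangent (snd w))) has_derivative
      (\<lambda>h. s * \<rho> * fst h - s * (1 - \<rho>) * snd h)) (at ?w)"
    using has_derivative_chord_component[OF oval chord(1) has_derivative_snd[OF has_derivative_ident]]
    unfolding chord fst_conv snd_conv frame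
    by (rule has_derivative_eq_rhs) (use chord(2) g in \<open>simp add: fun_eq_iff \<rho>_def field_simps\<close>)
  from has_derivative_Pair[OF has_derivative_snd[OF has_derivative_ident] this]
  show "(chord_end \<Gamma> has_derivative (\<lambda>h. (snd h, s * \<rho> * fst h - s * (1 - \<rho>) * snd h))) (at ?w)"
    by (simp add: chord_end_def[abs_def])
qed

lemma continuous_on_chord_start:
  assumes "oval \<Gamma>" "\<And>w. w \<in> S \<Longrightarrow> cis (fst w) \<noteq> cis (snd w)"
  shows "continuous_on S (chord_start \<Gamma>)"
proof -
  have "isCont (chord_start \<Gamma>) w" if "w \<in> S" for w
  proof -
    have "cis (fst w) \<noteq> cis (snd w)" using assms(2) that .
    note has_derivative_chord_component[OF assms(1) this has_derivative_fst[OF has_derivative_ident]]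
    from has_derivative_continuous[OF has_derivative_Pair[OF has_derivative_fst[OF has_derivative_ident] this]]
    show ?thesis by (simp add: chord_start_def[abs_def])
  qed
  then show ?thesis by (simp add: continuous_at_imp_continuous_on)
qed

text \<open>The determinant 1 is built into the shape of the matrix, since a * a - b * ((a^2 - 1) /
  b) = 1. The entries arise by composing the derivative of \<open>chord_end\<close> with the inverse
  of the lower triangular derivative of \<open>chord_start\<close>.\<close>

lemma has_quot_derivative_symmetric:
  fixes n m :: nat and \<phi> :: real
  assumes sym: "\<Gamma> \<in> sym_ovals n" and m: "1 \<le> m" "m < n"
    and crit: "nderiv (Suc 0) (support_fun \<Gamma>) \<phi> = 0"
  defines "a \<equiv> 2 * support_fun \<Gamma> \<phi> / curvature_radius \<Gamma> \<phi> - 1"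
  obtains b where "b \<noteq> 0"
    and "has_quot_derivative n m \<Gamma> (\<phi>, cos (m * pi / n))
      (\<lambda>h. (a * fst h + b * snd h, (a\<^sup>2 - 1) / b * fst h + a * snd h))"
proof -
  define \<alpha> where "\<alpha> = m * pi / n"
  define s where "s = sin \<alpha>"
  define \<rho> where "\<rho> = curvature_radius \<Gamma> \<phi> / (2 * support_fun \<Gamma> \<phi>)"
  \<comment> \<open>An open set of angle pairs with distinct endpoints, so that every pair spans a
    chord.\<close>
  define S :: "(real \<times> real) set" where "S = {w. fst w < snd w \<and> snd w < fst w + 2 * pi}"
  define w0 where "w0 = (\<phi>, \<phi> + 2 * \<alpha>)"
  let ?z = "(\<phi>, cos \<alpha>)"
  note oval = sym_oval[OF sym]
  note chord = symmetric_chord[OF sym m crit, folded \<alpha>_def, folded s_def]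
  note deriv = symmetric_chord_derivatives[OF sym m crit, folded \<alpha>_def, folded s_def \<rho>_def w0_def]
  have \<rho>: "\<rho> > 0"
    using support_fun_pos[OF sym] curvature_radius_pos[OF oval] m by (simp add: \<rho>_def)
  have a: "a = (1 - \<rho>) / \<rho>"
    using support_fun_pos[OF sym, of \<phi>] curvature_radius_pos[OF oval, of \<phi>] m
    by (simp add: a_def \<rho>_def field_simps)
  have "open S"
  proof -
    have "S = {w. fst w < snd w} \<inter> {w. snd w < fst w + 2 * pi}" by (auto simp: S_def)
    then show ?thesis by (auto intro!: open_Collect_less continuous_intros)
  qed
  have w0: "w0 \<in> S"
    using m by (auto simp: w0_def S_def \<alpha>_def field_simps)
  have distinct: "cis (fst w) \<noteq> cis (snd w)" if "w \<in> S" for w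
    using that by (intro cis_distinct) (simp_all add: S_def)
  have inj: "inj_on (chord_start \<Gamma>) S"
    unfolding S_def by (rule inj_on_chord_start[OF oval])
  have cont: "continuous_on S (chord_start \<Gamma>)"
    by (rule continuous_on_chord_start[OF oval distinct])
  \<comment> \<open>So the chord starts fill a neighbourhood of \<open>?z\<close>, as the identity
    required of the lift near \<open>?z\<close> demands.\<close>
  have open_image: "open (chord_start \<Gamma> ` S)"
    by (rule invariance_of_domain[OF cont \<open>open S\<close> inj])
  define pre where "pre = the_inv_into S (chord_start \<Gamma>)"
  have pre: "pre (chord_start \<Gamma> w) = w" if "w \<in> S" for w
    unfolding pre_def by (rule the_inv_into_f_f[OF inj that])
  have start: "chord_start \<Gamma> w0 = ?z" and "end": "chord_end \<Gamma> w0 = (\<phi> + 2 * \<alpha>, cos \<alpha>)"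
    by (simp_all add: w0_def chord_start_def chord_end_def chord inner_frame)
  \<comment> \<open>Solving p = s (1 - \<rho>) h - s \<rho> k for k gives k = a h - p / (s
    \<rho>).\<close>
  have "(pre has_derivative (\<lambda>h. (fst h, a * fst h - snd h / (s * \<rho>)))) (at (chord_start \<Gamma> w0))"
    by (rule has_derivative_inverse_strong[OF \<open>open S\<close> w0 cont pre deriv(1)])
      (use chord(2) \<rho> in \<open>auto simp: fun_eq_iff a field_simps\<close>)
  then have "(pre has_derivative (\<lambda>h. (fst h, a * fst h - snd h / (s * \<rho>)))) (at ?z)"
    by (simp add: start)
  moreover have "pre ?z = w0" using pre[OF w0] by (simp add: start)
  then have "(chord_end \<Gamma> has_derivative (\<lambda>h. (snd h, s * \<rho> * fst h - s * (1 - \<rho>) * snd h)))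
      (at (pre ?z))"
    using deriv(2) by simp
  ultimately have "((\<lambda>w. chord_end \<Gamma> (pre w)) has_derivative
      (\<lambda>h. (a * fst h - snd h / (s * \<rho>),
        s * \<rho> * fst h - s * (1 - \<rho>) * (a * fst h - snd h / (s * \<rho>))))) (at ?z)"
    by (rule has_derivative_compose[THEN has_derivative_eq_rhs]) simp
  \<comment> \<open>The angle 2 \<alpha> is one rotation step of the quotient: subtracting it leaves
    the class unchanged and makes the lift fix \<open>?z\<close>.\<close>
  from has_derivative_diff[OF this has_derivative_const[of "(2 * \<alpha>, 0)"]]
  have D: "((\<lambda>w. chord_end \<Gamma> (pre w) - (2 * \<alpha>, 0)) has_derivative
      (\<lambda>h. (a * fst h + (- 1 / (s * \<rho>)) * snd h,
        (a\<^sup>2 - 1) / (- 1 / (s * \<rho>)) * fst h + a * snd h))) (at ?z)"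
    by (rule has_derivative_eq_rhs) (use chord(2) \<rho> in \<open>simp add: fun_eq_iff a power2_eq_square field_simps\<close>)
  have "quot_pt n m (chord_end \<Gamma> (pre w) - (2 * \<alpha>, 0)) = quot_map n m \<Gamma> (quot_pt n m w)"
    if w: "w \<in> chord_start \<Gamma> ` S" for w
  proof -
    obtain x y where xy: "w = chord_start \<Gamma> (x, y)" "(x, y) \<in> S" using w by auto
    then have "cis x \<noteq> cis y" using distinct[OF xy(2)] by simp
    note quot_map_chord[OF sym this, of m] phase_chord_in_phase_space(2)[OF oval this]
    moreover have "chord_end \<Gamma> (x, y) - (2 * \<alpha>, 0) =
        chord_end \<Gamma> (x, y) + (of_int (- 1) * (2 * real m * pi / real n), 0)"
      by (simp add: \<alpha>_def prod_eq_iff)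
    ultimately show ?thesis
      unfolding xy(1) pre[OF xy(2)] by (metis quot_pt_shift)
  qed
  moreover have "?z \<in> chord_start \<Gamma> ` S" using start w0 by (metis imageI)
  ultimately have ev: "\<forall>\<^sub>F w in nhds ?z.
      quot_pt n m (chord_end \<Gamma> (pre w) - (2 * \<alpha>, 0)) = quot_map n m \<Gamma> (quot_pt n m w)"
    using open_image by (auto simp: eventually_nhds)
  have "chord_end \<Gamma> (pre ?z) - (2 * \<alpha>, 0) = ?z"
    using pre[OF w0] by (simp add: start "end")
  with D ev have "has_quot_derivative n m \<Gamma> ?z
      (\<lambda>h. (a * fst h + (- 1 / (s * \<rho>)) * snd h, (a\<^sup>2 - 1) / (- 1 / (s * \<rho>)) * fst h + a * snd h))"
    unfolding has_quot_derivative_def by (intro exI[of _ "\<lambda>w. chord_end \<Gamma> (pre w) - (2 * \<alpha>, 0)"] conjI)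
  then show ?thesis using chord(2) \<rho> that[of "- 1 / (s * \<rho>)"] by (simp add: \<alpha>_def)
qed


section \<open>Type of the symmetric orbits\<close>


text \<open>With b \<noteq> 0 the first row determines an eigenvector up to scale, namely (b, k -
  a); the second row is then the characteristic equation.\<close>

lemma eigenvalue_mat_2:
  fixes a b c d k :: "'a::field"
  assumes "b \<noteq> 0"
  shows "eigenvalue (mat_of_rows_list 2 [[a, b], [c, d]]) k \<longleftrightarrow> (k - a) * (k - d) = b * c"
proof -
  let ?A = "mat_of_rows_list 2 [[a, b], [c, d]]"
  have index: "?A $$ (0, 0) = a" "?A $$ (0, 1) = b" "?A $$ (1, 0) = c" "?A $$ (1, 1) = d"
    and dim: "dim_row ?A = 2" "dim_col ?A = 2"
    by (simp_all add: mat_of_rows_list_def)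
  have eq: "?A *\<^sub>v v = k \<cdot>\<^sub>v v \<longleftrightarrow> a * v $ 0 + b * v $ 1 = k * v $ 0 \<and> c * v $ 0 + d * v $ 1 = k * v $ 1"
    if "v \<in> carrier_vec 2" for v
  proof -
    have "(?A *\<^sub>v v) $ i = ?A $$ (i, 0) * v $ 0 + ?A $$ (i, 1) * v $ 1" if "i < 2" for i
      using that \<open>v \<in> carrier_vec 2\<close> dim
      by (simp add: scalar_prod_def sum.atLeast0_lessThan_Suc numeral_2_eq_2)
    then have "(?A *\<^sub>v v) $ 0 = a * v $ 0 + b * v $ 1" "(?A *\<^sub>v v) $ 1 = c * v $ 0 + d * v $ 1"
      using index by simp_all
    moreover have "?A *\<^sub>v v = k \<cdot>\<^sub>v v \<longleftrightarrow> (\<forall>i<2. (?A *\<^sub>v v) $ i = k * v $ i)"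
      using that dim by (auto simp: vec_eq_iff)
    ultimately show ?thesis by (auto simp: less_2_cases_iff)
  qed
  have zero: "v = 0\<^sub>v 2 \<longleftrightarrow> v $ 0 = 0 \<and> v $ 1 = 0" if "v \<in> carrier_vec 2" for v :: "'a vec"
    using that by (auto simp: vec_eq_iff less_2_cases_iff)
  show ?thesis
  proof
    assume "eigenvalue ?A k"
    then obtain v where v: "v \<in> carrier_vec 2" "v \<noteq> 0\<^sub>v 2" "?A *\<^sub>v v = k \<cdot>\<^sub>v v"
      by (auto simp: eigenvalue_def eigenvector_def dim)
    then have 1: "b * v $ 1 = (k - a) * v $ 0" and 2: "c * v $ 0 = (k - d) * v $ 1"
      using eq by (auto simp: algebra_simps)
    then have "v $ 0 \<noteq> 0" using v zero assms by auto
    have "b * c * v $ 0 = b * ((k - d) * v $ 1)" by (simp only: 2[symmetric] mult.assoc)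
    also have "\<dots> = (k - d) * (b * v $ 1)" by (simp only: mult.left_commute)
    also have "\<dots> = (k - a) * (k - d) * v $ 0" by (simp only: 1 mult_ac)
    finally show "(k - a) * (k - d) = b * c" using \<open>v $ 0 \<noteq> 0\<close> by simp
  next
    assume *: "(k - a) * (k - d) = b * c"
    define v where "v = vec 2 (\<lambda>i. if i = 0 then b else k - a)"
    have v: "v \<in> carrier_vec 2" "v $ 0 = b" "v $ 1 = k - a" by (simp_all add: v_def)
    have "?A *\<^sub>v v = k \<cdot>\<^sub>v v"
      unfolding eq[OF v(1)] v using * by (simp add: algebra_simps)
    then show "eigenvalue ?A k"
      using v assms zero[OF v(1)] by (auto simp: eigenvalue_def eigenvector_def dim)
  qed
qed

text \<open>The linear map with both diagonal entries \<open>a\<close> and determinant \<open>1\<close>; junk if \<open>b = 0\<close>.\<close>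

definition unimodular_jacobian :: "real \<Rightarrow> real \<Rightarrow> real \<times> real \<Rightarrow> real \<times> real" where
  "unimodular_jacobian a b = (\<lambda>h. (a * fst h + b * snd h, (a\<^sup>2 - 1) / b * fst h + a * snd h))"

lemma eigenvalue_unimodular_jacobian:
  assumes "b \<noteq> 0"
  shows "eigenvalue (jacobian_mat (unimodular_jacobian a b)) \<mu> \<longleftrightarrow> (\<mu> - of_real a)\<^sup>2 = of_real (a\<^sup>2 - 1)"
proof -
  have "jacobian_mat (unimodular_jacobian a b) = mat_of_rows_list 2
      [[complex_of_real a, of_real b], [of_real ((a\<^sup>2 - 1) / b), of_real a]]"
    unfolding jacobian_mat_def unimodular_jacobian_def
    by (rule eq_matI) (auto simp: mat_of_rows_list_def less_Suc_eq numeral_2_eq_2)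
  then show ?thesis
    using assms by (simp add: eigenvalue_mat_2 power2_eq_square)
qed

lemma square_eq_of_real_iff:
  "(z::complex)\<^sup>2 = of_real r \<longleftrightarrow> Re z * Im z = 0 \<and> (Re z)\<^sup>2 - (Im z)\<^sup>2 = r"
  by (auto simp: complex_eq_iff power2_eq_square)

text \<open>For |a| < 1 an eigenvalue has real part a and squared imaginary part 1 - a^2, hence
  modulus 1. For |a| \<ge> 1 the root a + sqrt (a^2 - 1) is real, so the parabolic case |a| = 1 is
  excluded too.\<close>

lemma unimodular_jacobian_elliptic_iff:
  assumes "b \<noteq> 0"
  shows "(\<forall>\<mu>. eigenvalue (jacobian_mat (unimodular_jacobian a b)) \<mu> \<longrightarrow> \<mu> \<notin> \<real> \<and> cmod \<mu> = 1) \<longleftrightarrow> \<bar>a\<bar> < 1"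
  unfolding eigenvalue_unimodular_jacobian[OF assms]
proof
  assume *: "\<forall>\<mu>. (\<mu> - of_real a)\<^sup>2 = of_real (a\<^sup>2 - 1) \<longrightarrow> \<mu> \<notin> \<real> \<and> cmod \<mu> = 1"
  show "\<bar>a\<bar> < 1"
  proof (rule ccontr)
    assume "\<not> \<bar>a\<bar> < 1"
    then have "(sqrt (a\<^sup>2 - 1))\<^sup>2 = a\<^sup>2 - 1"
      by (simp add: abs_square_less_1[symmetric])
    then have "(complex_of_real (a + sqrt (a\<^sup>2 - 1)) - of_real a)\<^sup>2 = of_real (a\<^sup>2 - 1)"
      by (simp flip: of_real_power)
    then show False using * Reals_of_real by blast
  qed
next
  assume "\<bar>a\<bar> < 1"
  then have a: "a\<^sup>2 < 1" by (simp add: abs_square_less_1)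
  show "\<forall>\<mu>. (\<mu> - of_real a)\<^sup>2 = of_real (a\<^sup>2 - 1) \<longrightarrow> \<mu> \<notin> \<real> \<and> cmod \<mu> = 1"
  proof (intro allI impI)
    fix \<mu> :: complex
    assume "(\<mu> - of_real a)\<^sup>2 = of_real (a\<^sup>2 - 1)"
    then have *: "(Re \<mu> - a) * Im \<mu> = 0" "(Re \<mu> - a)\<^sup>2 - (Im \<mu>)\<^sup>2 = a\<^sup>2 - 1"
      unfolding square_eq_of_real_iff by simp_all
    have "Im \<mu> \<noteq> 0"
      using *(2) a zero_le_power2[of "Re \<mu> - a"] by (intro notI) (simp add: algebra_simps)
    then have "Re \<mu> = a" using *(1) by simp
    then have "(cmod \<mu>)\<^sup>2 = 1\<^sup>2" using *(2) by (simp add: cmod_power2)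
    then have "cmod \<mu> = 1" by (rule power2_eq_imp_eq) simp_all
    then show "\<mu> \<notin> \<real> \<and> cmod \<mu> = 1"
      using \<open>Im \<mu> \<noteq> 0\<close> by (simp add: complex_is_Real_iff)
  qed
qed

text \<open>For |a| \<le> 1 the root a + i sqrt (1 - a^2) lies on the unit circle. For |a| > 1 the
  roots are real, and a root 1 or - 1 would force a to have that same value.\<close>

lemma unimodular_jacobian_hyperbolic_iff:
  assumes "b \<noteq> 0"
  shows "(\<forall>\<mu>. eigenvalue (jacobian_mat (unimodular_jacobian a b)) \<mu> \<longrightarrow> \<mu> \<in> \<real> \<and> cmod \<mu> \<noteq> 1) \<longleftrightarrow> \<bar>a\<bar> > 1"
  unfolding eigenvalue_unimodular_jacobian[OF assms]
proof
  assume *: "\<forall>\<mu>. (\<mu> - of_real a)\<^sup>2 = of_real (a\<^sup>2 - 1) \<longrightarrow> \<mu> \<in> \<real> \<and> cmod \<mu> \<noteq> 1"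
  show "\<bar>a\<bar> > 1"
  proof (rule ccontr)
    assume "\<not> \<bar>a\<bar> > 1"
    then have "a\<^sup>2 \<le> 1" by (simp add: abs_square_le_1)
    then have "(Complex a (sqrt (1 - a\<^sup>2)) - of_real a)\<^sup>2 = of_real (a\<^sup>2 - 1)"
      unfolding square_eq_of_real_iff by simp
    then have "Complex a (sqrt (1 - a\<^sup>2)) \<in> \<real>" "cmod (Complex a (sqrt (1 - a\<^sup>2))) \<noteq> 1"
      using * by blast+
    then show False using \<open>a\<^sup>2 \<le> 1\<close> by (simp add: cmod_def)
  qed
next
  assume "\<bar>a\<bar> > 1"
  then have a: "a\<^sup>2 > 1" using abs_square_le_1[of a] by linarith
  show "\<forall>\<mu>. (\<mu> - of_real a)\<^sup>2 = of_real (a\<^sup>2 - 1) \<longrightarrow> \<mu> \<in> \<real> \<and> cmod \<mu> \<noteq> 1"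
  proof (intro allI impI)
    fix \<mu> :: complex
    assume "(\<mu> - of_real a)\<^sup>2 = of_real (a\<^sup>2 - 1)"
    then have *: "(Re \<mu> - a) * Im \<mu> = 0" "(Re \<mu> - a)\<^sup>2 - (Im \<mu>)\<^sup>2 = a\<^sup>2 - 1"
      unfolding square_eq_of_real_iff by simp_all
    have "Im \<mu> = 0"
    proof (rule ccontr)
      assume "Im \<mu> \<noteq> 0"
      then have "Re \<mu> = a" using *(1) by simp
      then show False using *(2) a zero_le_power2[of "Im \<mu>"] by (simp add: algebra_simps)
    qed
    moreover have "\<bar>Re \<mu>\<bar> \<noteq> 1"
    proof
      assume "\<bar>Re \<mu>\<bar> = 1"
      then have "Re \<mu> = 1 \<or> Re \<mu> = - 1" by linarith
      then have "a = 1 \<or> a = - 1"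
        using *(2) \<open>Im \<mu> = 0\<close> by (auto simp: power2_eq_square algebra_simps)
      then show False using a by auto
    qed
    ultimately show "\<mu> \<in> \<real> \<and> cmod \<mu> \<noteq> 1"
      by (simp add: complex_is_Real_iff cmod_def)
  qed
qed

text \<open>Uniqueness of the derivative turns the existential definitions into conditions on this
  one matrix. As g and R are positive, a > - 1, so only the comparison of a with 1 matters.\<close>

lemma symmetric_fixpoint_type:
  fixes n m :: nat and \<phi> :: real
  assumes sym: "\<Gamma> \<in> sym_ovals n" and m: "1 \<le> m" "m < n"
    and crit: "nderiv (Suc 0) (support_fun \<Gamma>) \<phi> = 0"
  shows "elliptic_fixpoint n m \<Gamma> (\<phi>, cos (m * pi / n)) \<longleftrightarrow> nderiv 2 (support_fun \<Gamma>) \<phi> > 0"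
    and "hyperbolic_fixpoint n m \<Gamma> (\<phi>, cos (m * pi / n)) \<longleftrightarrow> nderiv 2 (support_fun \<Gamma>) \<phi> < 0"
proof -
  let ?z = "(\<phi>, cos (m * pi / n))" and ?g = "support_fun \<Gamma>" and ?R = "curvature_radius \<Gamma> \<phi>"
  define a where "a = 2 * ?g \<phi> / ?R - 1"
  have g: "?g \<phi> > 0" and R: "?R > 0"
    using support_fun_pos[OF sym] curvature_radius_pos[OF sym_oval[OF sym]] m by auto
  obtain b where b: "b \<noteq> 0" "has_quot_derivative n m \<Gamma> ?z (unimodular_jacobian a b)"
    by (rule has_quot_derivative_symmetric[OF sym m crit, folded a_def, folded unimodular_jacobian_def])
  have "0 < m * pi / n" "m * pi / n < pi" using m by (auto simp: field_simps)
  then have "cos (m * pi / n) < 1" "cos (m * pi / n) > - 1"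
    using cos_monotone_0_pi[of 0 "m * pi / n"] cos_monotone_0_pi[of "m * pi / n" pi] by auto
  then have "\<bar>snd ?z\<bar> < 1" by simp
  then have unique: "D = unimodular_jacobian a b" if "has_quot_derivative n m \<Gamma> ?z D" for D
    using has_quot_derivative_unique[OF _ _ that b(2)] m by simp
  have "a > - 1" using g R by (simp add: a_def)
  \<comment> \<open>The condition a < 1 says g < R = g + g''.\<close>
  moreover have "a < 1 \<longleftrightarrow> nderiv 2 ?g \<phi> > 0" "a > 1 \<longleftrightarrow> nderiv 2 ?g \<phi> < 0"
    using R unfolding a_def by (auto simp: field_simps curvature_radius_def)
  ultimately have a: "\<bar>a\<bar> < 1 \<longleftrightarrow> nderiv 2 ?g \<phi> > 0" "\<bar>a\<bar> > 1 \<longleftrightarrow> nderiv 2 ?g \<phi> < 0"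
    by auto
  show "elliptic_fixpoint n m \<Gamma> ?z \<longleftrightarrow> nderiv 2 ?g \<phi> > 0"
    unfolding elliptic_fixpoint_def a[symmetric] unimodular_jacobian_elliptic_iff[OF b(1), symmetric]
    using b(2) unique by blast
  show "hyperbolic_fixpoint n m \<Gamma> ?z \<longleftrightarrow> nderiv 2 ?g \<phi> < 0"
    unfolding hyperbolic_fixpoint_def a[symmetric] unimodular_jacobian_hyperbolic_iff[OF b(1), symmetric]
    using b(2) unique by blast
qed

lemma sym_pt_type:
  assumes sym: "\<Gamma> \<in> sym_ovals n" and "n \<ge> 2" and crit: "support_critical \<Gamma> \<phi>"
    and idx: "(k, m) \<in> sym_indices n"
  shows "elliptic_fixpoint n m \<Gamma> (sym_pt n \<phi> k m) \<longleftrightarrow> nderiv 2 (support_fun \<Gamma>) \<phi> > 0"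
    and "hyperbolic_fixpoint n m \<Gamma> (sym_pt n \<phi> k m) \<longleftrightarrow> nderiv 2 (support_fun \<Gamma>) \<phi> < 0"
proof -
  let ?x = "\<phi> + 2 * real k * pi / n"
  have shift: "nderiv j (support_fun \<Gamma>) ?x = nderiv j (support_fun \<Gamma>) \<phi>" for j
    using periodic_nat[OF periodic_nderiv[OF C_infinity_support_fun[OF sym_oval[OF sym]]
          support_fun_periodic[OF sym]], of j \<phi> k]
    by (simp add: mult_ac)
  have m: "1 \<le> m" "m < n" using idx \<open>n \<ge> 2\<close> by (auto simp: sym_indices_def)
  have "nderiv (Suc 0) (support_fun \<Gamma>) ?x = 0"
    using crit support_critical_iff[OF sym_oval[OF sym]] by (simp only: shift)
  note type = symmetric_fixpoint_type[OF sym m this]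
  show "elliptic_fixpoint n m \<Gamma> (sym_pt n \<phi> k m) \<longleftrightarrow> nderiv 2 (support_fun \<Gamma>) \<phi> > 0"
    "hyperbolic_fixpoint n m \<Gamma> (sym_pt n \<phi> k m) \<longleftrightarrow> nderiv 2 (support_fun \<Gamma>) \<phi> < 0"
    unfolding sym_pt_def type shift by (rule refl)+
qed

text \<open>Abstract in P and Q so that both types share one proof. An orbit may be presented by a
  critical point other than the one defining its family; as both sides only ask for some critical
  point, the presenting one is the witness.\<close>

lemma sym_families_iff:
  assumes "n \<ge> 2"
    and "\<And>\<phi> k m. \<lbrakk>support_critical \<Gamma> \<phi>; (k, m) \<in> sym_indices n\<rbrakk> \<Longrightarrow> P m (sym_pt n \<phi> k m) \<longleftrightarrow> Q \<phi>"
  shows "(\<exists>\<F>\<in>sym_families n \<Gamma>. \<forall>S\<in>\<F>. \<exists>\<phi> k m. support_critical \<Gamma> \<phi> \<and> (k, m) \<in> sym_indices n \<and>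
      S = billiard_orbit \<Gamma> (phase (sym_pt n \<phi> k m)) \<and> P m (sym_pt n \<phi> k m)) \<longleftrightarrow>
    (\<exists>\<phi>. support_critical \<Gamma> \<phi> \<and> Q \<phi>)" (is "?L \<longleftrightarrow> ?R")
proof
  \<comment> \<open>A family without indices would be empty and vacuously of either type; n \<ge> 2
    supplies an orbit.\<close>
  have idx: "(0, 1) \<in> sym_indices n" using assms(1) by (simp add: sym_indices_def)
  show ?R if ?L
  proof -
    from that obtain \<phi> where family: "\<forall>S\<in>sym_family n \<Gamma> \<phi>. \<exists>\<phi> k m. support_critical \<Gamma> \<phi> \<and>
        (k, m) \<in> sym_indices n \<and> S = billiard_orbit \<Gamma> (phase (sym_pt n \<phi> k m)) \<and> P m (sym_pt n \<phi> k m)"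
      unfolding sym_families_def by blast
    have "billiard_orbit \<Gamma> (phase (sym_pt n \<phi> 0 1)) \<in> sym_family n \<Gamma> \<phi>"
      unfolding sym_family_def using idx by force
    from bspec[OF family this] obtain \<phi>' k m where
      "support_critical \<Gamma> \<phi>'" "(k, m) \<in> sym_indices n" "P m (sym_pt n \<phi>' k m)"
      by (elim exE conjE)
    then show ?R using assms(2)[of \<phi>' k m] by (intro exI[of _ \<phi>']) simp
  qed
  show ?L if ?R
  proof -
    from that obtain \<phi> where \<phi>: "support_critical \<Gamma> \<phi>" "Q \<phi>" by blast
    have "\<exists>\<phi> k m. support_critical \<Gamma> \<phi> \<and> (k, m) \<in> sym_indices n \<and>
        S = billiard_orbit \<Gamma> (phase (sym_pt n \<phi> k m)) \<and> P m (sym_pt n \<phi> k m)"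
      if S: "S \<in> sym_family n \<Gamma> \<phi>" for S
    proof -
      from S obtain k m where
        km: "(k, m) \<in> sym_indices n" "S = billiard_orbit \<Gamma> (phase (sym_pt n \<phi> k m))"
        unfolding sym_family_def by (elim imageE) auto
      with \<phi> assms(2)[OF \<phi>(1) km(1)] show ?thesis
        by (intro exI[of _ \<phi>] exI[of _ k] exI[of _ m]) simp
    qed
    moreover have "sym_family n \<Gamma> \<phi> \<in> sym_families n \<Gamma>"
      unfolding sym_families_def using \<phi>(1) by blast
    ultimately show ?L by (intro bexI[of _ "sym_family n \<Gamma> \<phi>"] ballI)
  qed
qed

lemma elliptic_hyperbolic_ovals_iff:
  assumes "n \<ge> 2"
  shows "\<Gamma> \<in> elliptic_hyperbolic_ovals n \<longleftrightarrow> \<Gamma> \<in> sym_ovals n \<and>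
    (\<exists>x. nderiv 1 (support_fun \<Gamma>) x = 0 \<and> nderiv 2 (support_fun \<Gamma>) x > 0) \<and>
    (\<exists>x. nderiv 1 (support_fun \<Gamma>) x = 0 \<and> nderiv 2 (support_fun \<Gamma>) x < 0)"
proof (cases "\<Gamma> \<in> sym_ovals n")
  case True
  note type = sym_pt_type[OF True assms]
  have "(\<exists>\<F>\<in>sym_families n \<Gamma>. elliptic_family n \<Gamma> \<F>) \<longleftrightarrow>
      (\<exists>x. support_critical \<Gamma> x \<and> nderiv 2 (support_fun \<Gamma>) x > 0)"
    unfolding elliptic_family_def elliptic_orbit_def
    by (rule sym_families_iff[OF assms]) (rule type(1))
  moreover have "(\<exists>\<F>\<in>sym_families n \<Gamma>. hyperbolic_family n \<Gamma> \<F>) \<longleftrightarrow>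
      (\<exists>x. support_critical \<Gamma> x \<and> nderiv 2 (support_fun \<Gamma>) x < 0)"
    unfolding hyperbolic_family_def hyperbolic_orbit_def
    by (rule sym_families_iff[OF assms]) (rule type(2))
  ultimately show ?thesis
    using True by (simp add: elliptic_hyperbolic_ovals_def support_critical_iff[OF sym_oval[OF True]])
qed (simp add: elliptic_hyperbolic_ovals_def)


section \<open>Openness and density\<close>


lemma nderiv_add:
  assumes "C_infinity f" "C_infinity g"
  shows "nderiv k (\<lambda>x. f x + g x) = (\<lambda>x. nderiv k f x + nderiv k g x)"
proof (induction k)
  case (Suc k)
  show ?case
    by (rule nderiv_Suc_eqI[OF Suc])
      (intro has_vector_derivative_add C_infinity_has_vector_derivative assms)
qed simp

lemma nderiv_cmult:
  fixes f :: "real \<Rightarrow> real"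
  assumes "C_infinity f"
  shows "nderiv k (\<lambda>x. c * f x) = (\<lambda>x. c * nderiv k f x)"
proof (induction k)
  case (Suc k)
  show ?case
    by (rule nderiv_Suc_eqI[OF Suc])
      (intro has_vector_derivative_mult_right C_infinity_has_vector_derivative assms)
qed simp

text \<open>Every Leibniz term other than f'' g carries a factor f or f', which vanishes at x. This
  evaluates the bump at its two centres.\<close>

lemma nderiv_product_at_double_zero:
  fixes f g :: "real \<Rightarrow> real"
  assumes "C_infinity f" "C_infinity g" and "f x = 0" "nderiv 1 f x = 0"
  shows "nderiv 1 (\<lambda>x. f x * g x) x = 0" "nderiv 2 (\<lambda>x. f x * g x) x = nderiv 2 f x * g x"
proof -
  have deriv: "((\<lambda>x. nderiv i f x * nderiv j g x) has_vector_derivative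
      (nderiv i f x * nderiv (Suc j) g x + nderiv (Suc i) f x * nderiv j g x)) (at x)" for i j x
    by (intro has_vector_derivative_mult C_infinity_has_vector_derivative assms)
  have 1: "nderiv (Suc 0) (\<lambda>x. f x * g x) = (\<lambda>x. f x * nderiv (Suc 0) g x + nderiv (Suc 0) f x * g x)"
    using deriv[of 0 0] by (intro nderiv_Suc_eqI[OF nderiv_0]) simp
  have "nderiv (Suc (Suc 0)) (\<lambda>x. f x * g x) =
      (\<lambda>x. (f x * nderiv (Suc (Suc 0)) g x + nderiv (Suc 0) f x * nderiv (Suc 0) g x) +
        (nderiv (Suc 0) f x * nderiv (Suc 0) g x + nderiv (Suc (Suc 0)) f x * g x))"
    using deriv[of 0 "Suc 0"] deriv[of "Suc 0" 0]
    by (intro nderiv_Suc_eqI[OF 1] has_vector_derivative_add) simp_all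
  then show "nderiv 1 (\<lambda>x. f x * g x) x = 0" "nderiv 2 (\<lambda>x. f x * g x) x = nderiv 2 f x * g x"
    using assms(3,4) 1 by (simp_all add: numeral_2_eq_2)
qed

lemma periodic_smooth_bounded:
  fixes f :: "real \<Rightarrow> real"
  assumes "C_infinity f" "periodic P f" "P > 0"
  obtains B where "\<And>x. \<bar>nderiv k f x\<bar> \<le> B"
proof -
  note extrema = periodic_extrema[OF periodic_nderiv[OF assms(1,2)] assms(3) C_infinity_isCont[OF assms(1)]]
  obtain a where "\<And>x. nderiv k f x \<le> nderiv k f a"
    using extrema(1) by blast
  moreover obtain b where "\<And>x. nderiv k f b \<le> nderiv k f x"
    using extrema(2) by blast
  ultimately have "\<bar>nderiv k f x\<bar> \<le> max \<bar>nderiv k f a\<bar> \<bar>nderiv k f b\<bar>" for x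
    by (smt (verit))
  then show ?thesis using that by blast
qed

text \<open>If f''(a) > 0, then f' would rise from 0 and be positive just to the right of a, so f
  would climb above its maximum.\<close>

lemma C_infinity_second_derivative_at_maximum:
  fixes f :: "real \<Rightarrow> real"
  assumes "C_infinity f" "\<And>x. f x \<le> f a"
  shows "nderiv 1 f a = 0" "nderiv 2 f a \<le> 0"
proof -
  have deriv: "(f has_real_derivative nderiv 1 f x) (at x)" for x
    using C_infinity_has_real_derivative[OF assms(1), of 0] by simp
  show crit: "nderiv 1 f a = 0"
    using DERIV_local_max[OF deriv[of a], of 1] assms(2) by simp
  show "nderiv 2 f a \<le> 0"
  proof (rule ccontr)
    assume "\<not> nderiv 2 f a \<le> 0"
    then obtain d where d: "d > 0" "\<And>h. \<lbrakk>h > 0; h < d\<rbrakk> \<Longrightarrow> nderiv 1 f a < nderiv 1 f (a + h)"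
      using DERIV_pos_inc_right[OF C_infinity_has_real_derivative[OF assms(1), of 1 a]]
      by (auto simp: numeral_2_eq_2)
    have "f a < f (a + d / 2)"
    proof (rule DERIV_pos_imp_increasing_open[where f = f])
      fix x assume "a < x" "x < a + d / 2"
      then have "nderiv 1 f x > 0" using d(2)[of "x - a"] d(1) crit by simp
      then show "\<exists>y. (f has_real_derivative y) (at x) \<and> 0 < y" using deriv by blast
    next
      show "continuous_on {a..a + d / 2} f"
        using deriv DERIV_isCont continuous_at_imp_continuous_on by blast
    qed (use d in auto)
    then show False using assms(2)[of "a + d / 2"] by simp
  qed
qed

lemma C_infinity_second_derivative_at_minimum:
  fixes f :: "real \<Rightarrow> real"
  assumes "C_infinity f" "\<And>x. f a \<le> f x"
  shows "nderiv 1 f a = 0" "nderiv 2 f a \<ge> 0"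
  using C_infinity_second_derivative_at_maximum[of "\<lambda>x. - 1 * f x" a]
    C_infinity_minus[OF assms(1)] assms(2) nderiv_cmult[OF assms(1), of _ "- 1"]
  by simp_all

text \<open>A nondegenerate critical point is detected by a sign change of the first derivative, which
  survives \<open>C\<^sup>2\<close>-small perturbations.\<close>

lemma nondegenerate_minimum_stable:
  fixes g :: "real \<Rightarrow> real"
  assumes "C_infinity g" "nderiv 1 g a = 0" "nderiv 2 g a > 0"
  shows "\<exists>r>0. \<forall>f. C_infinity f \<and> (\<forall>k\<le>2. \<forall>x. \<bar>nderiv k g x - nderiv k f x\<bar> < r) \<longrightarrow>
    (\<exists>x. nderiv 1 f x = 0 \<and> nderiv 2 f x > 0)"
proof -
  have deriv: "(nderiv 1 g has_real_derivative nderiv 2 g x) (at x)" for x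
    using C_infinity_has_real_derivative[OF assms(1), of 1] by (simp add: numeral_2_eq_2)
  \<comment> \<open>Half of g''(a), so that continuity keeps g'' above \<open>c\<close> on a whole
    interval around a.\<close>
  define c where "c = nderiv 2 g a / 2"
  have c: "c > 0" using assms(3) by (simp add: c_def)
  have "nderiv 2 g \<midarrow>a\<rightarrow> nderiv 2 g a"
    using C_infinity_isCont[OF assms(1)] isCont_def by blast
  then obtain e where e: "e > 0" "\<And>x. \<lbrakk>x \<noteq> a; \<bar>x - a\<bar> < e\<rbrakk> \<Longrightarrow> \<bar>nderiv 2 g x - nderiv 2 g a\<bar> < c"
    using LIM_D[of "nderiv 2 g" "nderiv 2 g a" a c] c by auto
  define d where "d = e / 2"
  have d: "d > 0" using e by (simp add: d_def)
  have conv: "nderiv 2 g x > c" if "\<bar>x - a\<bar> \<le> d" for x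
    using e(2)[of x] that e(1) c by (cases "x = a") (auto simp: d_def c_def abs_if split: if_splits)
  have left: "nderiv 1 g (a - d) < 0"
    using DERIV_pos_imp_increasing[of "a - d" a "nderiv 1 g"] d deriv conv c assms(2)
    by (smt (verit))
  have right: "nderiv 1 g (a + d) > 0"
    using DERIV_pos_imp_increasing[of a "a + d" "nderiv 1 g"] d deriv conv c assms(2)
    by (smt (verit))
  \<comment> \<open>The bound \<open>c\<close> keeps f'' positive where g'' > c; the other two
    preserve the signs at a - d and a + d, which forces a zero of f' in between.\<close>
  define r where "r = min c (min (- nderiv 1 g (a - d)) (nderiv 1 g (a + d)))"
  have "r > 0" using c left right by (simp add: r_def)
  moreover have "\<forall>f. C_infinity f \<and> (\<forall>k\<le>2. \<forall>x. \<bar>nderiv k g x - nderiv k f x\<bar> < r) \<longrightarrow>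
    (\<exists>x. nderiv 1 f x = 0 \<and> nderiv 2 f x > 0)"
  proof (intro allI impI, elim conjE)
    fix f :: "real \<Rightarrow> real"
    assume f: "C_infinity f" and "\<forall>k\<le>2. \<forall>x. \<bar>nderiv k g x - nderiv k f x\<bar> < r"
    then have close: "\<bar>nderiv k g x - nderiv k f x\<bar> < r" if "k \<le> 2" for k x
      using that by blast
    have "nderiv 1 f (a - d) \<le> 0" "0 \<le> nderiv 1 f (a + d)"
      using close[of 1 "a - d"] close[of 1 "a + d"] by (auto simp: r_def)
    then obtain x where x: "a - d \<le> x" "x \<le> a + d" "nderiv 1 f x = 0"
      using IVT'[of "nderiv 1 f" "a - d" 0 "a + d"] d
        continuous_at_imp_continuous_on[of _ "nderiv 1 f"] C_infinity_isCont[OF f]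
      by fastforce
    then have "nderiv 2 g x > c" by (intro conv) auto
    then have "nderiv 2 f x > 0" using close[of 2 x] by (auto simp: r_def)
    then show "\<exists>x. nderiv 1 f x = 0 \<and> nderiv 2 f x > 0" using x(3) by blast
  qed
  ultimately show ?thesis by blast
qed

lemma nondegenerate_maximum_stable:
  fixes g :: "real \<Rightarrow> real"
  assumes "C_infinity g" "nderiv 1 g a = 0" "nderiv 2 g a < 0"
  shows "\<exists>r>0. \<forall>f. C_infinity f \<and> (\<forall>k\<le>2. \<forall>x. \<bar>nderiv k g x - nderiv k f x\<bar> < r) \<longrightarrow>
    (\<exists>x. nderiv 1 f x = 0 \<and> nderiv 2 f x < 0)"
proof -
  have neg: "nderiv k (\<lambda>x. - f x) = (\<lambda>x. - nderiv k f x)" if "C_infinity f"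
    for k and f :: "real \<Rightarrow> real"
    using nderiv_cmult[OF that, of k "- 1"] by simp
  have "nderiv 1 (\<lambda>x. - g x) a = 0" "nderiv 2 (\<lambda>x. - g x) a > 0"
    using assms by (simp_all add: neg)
  from nondegenerate_minimum_stable[OF C_infinity_minus[OF assms(1)] this]
  obtain r where r: "r > 0" "\<forall>f. C_infinity f \<and>
      (\<forall>k\<le>2. \<forall>x. \<bar>nderiv k (\<lambda>x. - g x) x - nderiv k f x\<bar> < r) \<longrightarrow>
      (\<exists>x. nderiv 1 f x = 0 \<and> nderiv 2 f x > 0)"
    by blast
  have "\<forall>f. C_infinity f \<and> (\<forall>k\<le>2. \<forall>x. \<bar>nderiv k g x - nderiv k f x\<bar> < r) \<longrightarrow>
    (\<exists>x. nderiv 1 f x = 0 \<and> nderiv 2 f x < 0)"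
  proof (intro allI impI, elim conjE)
    fix f :: "real \<Rightarrow> real"
    assume f: "C_infinity f" and close: "\<forall>k\<le>2. \<forall>x. \<bar>nderiv k g x - nderiv k f x\<bar> < r"
    have "\<forall>k\<le>2. \<forall>x. \<bar>nderiv k (\<lambda>x. - g x) x - nderiv k (\<lambda>x. - f x) x\<bar> < r"
      using close by (simp add: neg[OF f] neg[OF assms(1)] abs_minus_commute)
    with r(2) C_infinity_minus[OF f]
    have "\<exists>x. nderiv 1 (\<lambda>x. - f x) x = 0 \<and> nderiv 2 (\<lambda>x. - f x) x > 0" by blast
    then show "\<exists>x. nderiv 1 f x = 0 \<and> nderiv 2 f x < 0"
      by (simp add: neg[OF f])
  qed
  with r(1) show ?thesis by blast
qed

section \<open>Pointwise bounds and the perturbation in the C2 distance\<close>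

lemma C2_dist_upper:
  assumes "f \<in> support_space n" "g \<in> support_space n" "n > 0" "k \<le> 2"
  shows "\<bar>nderiv k f x - nderiv k g x\<bar> \<le> C2_dist n f g"
proof -
  have diff: "nderiv k (\<lambda>x. f x - g x) x = nderiv k f x - nderiv k g x" for x
    using C2_parts(1)[OF assms] by simp
  have "bounded (range (\<lambda>x. nderiv k f x - nderiv k g x))"
    using C2_parts(2)[OF assms] C2_parts(2)[OF assms(2,2-4)] by (rule bounded_minus_comp)
  then obtain c where "\<And>x. \<bar>nderiv k f x - nderiv k g x\<bar> \<le> c"
    by (auto simp: bounded_iff)
  then have "\<bar>nderiv k f x - nderiv k g x\<bar> \<le> (SUP x. \<bar>nderiv k (\<lambda>x. f x - g x) x\<bar>)"
    unfolding diff by (intro cSUP_upper bdd_aboveI2) auto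
  also have "\<dots> \<le> C2_dist n f g"
    using assms by (simp add: C2_dist_def C2_norm_def)
  finally show ?thesis .
qed

lemma C2_dist_least:
  assumes "f \<in> support_space n" "g \<in> support_space n" "n > 0"
    and "\<And>k x. k \<le> 2 \<Longrightarrow> \<bar>nderiv k f x - nderiv k g x\<bar> \<le> c"
  shows "C2_dist n f g \<le> c"
  using assms C2_parts(1)[OF assms(1-3)]
  by (auto simp: C2_dist_def C2_norm_def intro!: cSUP_least)

text \<open>The perturbation direction is \<open>u\<^sub>a u\<^sub>b (u\<^sub>a - u\<^sub>b)\<close> with \<open>u\<^sub>c x = 1 - cos (n (x - c))\<close>: near
  \<open>a\<close> it is \<open>- u\<^sub>b(a)\<^sup>2 u\<^sub>a\<close> to second order, near \<open>b\<close> it is \<open>u\<^sub>a(b)\<^sup>2 u\<^sub>b\<close>.\<close>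

lemma periodic_bump:
  fixes a b :: real and n :: nat
  assumes "n > 0" "cos (real n * (a - b)) \<noteq> 1"
  obtains h :: "real \<Rightarrow> real" where "C_infinity h" "periodic (2 * pi / n) h"
    "nderiv 1 h a = 0" "nderiv 2 h a < 0" "nderiv 1 h b = 0" "nderiv 2 h b > 0"
proof -
  \<comment> \<open>Sums and products in place of differences, matching
    \<open>C_infinity_add\<close> and \<open>C_infinity_mult\<close>.\<close>
  define u where "u c x = 1 + - 1 * cos (real n * x + - (real n * c))" for c x :: real
  have smooth: "C_infinity (u c)" for c
    unfolding u_def by (intro C_infinity_add C_infinity_mult C_infinity_const C_infinity_cos)
  have u: "u c c = 0" for c by (simp add: u_def)
  have u1: "nderiv (Suc 0) (u c) = (\<lambda>x. n * sin (real n * x + - (real n * c)))" for c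
    by (rule nderiv_Suc_eqI[OF nderiv_0])
      (auto simp: u_def[abs_def] has_real_derivative_iff_has_vector_derivative[symmetric] intro!: derivative_eq_intros)
  have u2: "nderiv (Suc (Suc 0)) (u c) = (\<lambda>x. (real n)\<^sup>2 * cos (real n * x + - (real n * c)))" for c
    by (rule nderiv_Suc_eqI[OF u1])
      (auto simp: has_real_derivative_iff_has_vector_derivative[symmetric] power2_eq_square
        intro!: derivative_eq_intros)
  define h where "h x = u a x * (u b x * (u a x + - 1 * u b x))" for x
  \<comment> \<open>The factor with its double zero at b comes first, as
    \<open>nderiv_product_at_double_zero\<close> expects it.\<close>
  have h_b: "h = (\<lambda>x. u b x * (u a x * (u a x + - 1 * u b x)))"
    by (auto simp: h_def)
  \<comment> \<open>A cosine other than 1 is below 1, so each factor is positive at the centre of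
    the other.\<close>
  have ub: "u b a > 0" "u a b = u b a"
    using order.not_eq_order_implies_strict[OF assms(2) cos_le_one] cos_minus[of "real n * (a - b)"]
    by (simp_all add: u_def algebra_simps)
  have double_zero: "nderiv 1 (u c) c = 0" "nderiv 2 (u c) c = (real n)\<^sup>2" for c
    using u1 u2 by (simp_all add: numeral_2_eq_2)
  have rest: "C_infinity (\<lambda>x. u c x * (u a x + - 1 * u b x))" for c
    by (intro C_infinity_add C_infinity_mult C_infinity_const smooth)
  show ?thesis
  proof
    show "C_infinity h"
      unfolding h_def by (intro C_infinity_mult smooth rest)
    have "u c (x + 2 * pi / n) = u c x" for c x
    proof -
      have "real n * (x + 2 * pi / n) + - (real n * c) = (real n * x + - (real n * c)) + 2 * pi"
        using assms(1) by (simp add: field_simps)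
      then show ?thesis unfolding u_def by (simp only: cos_periodic)
    qed
    then show "periodic (2 * pi / n) h"
      by (simp add: periodic_def h_def)
    have "nderiv 2 h a = (real n)\<^sup>2 * (u b a * (u a a + - 1 * u b a))" "nderiv 1 h a = 0"
      using nderiv_product_at_double_zero[OF smooth rest u double_zero(1), of a b]
      unfolding double_zero(2) h_def by auto
    moreover have "(real n)\<^sup>2 * (u b a * (u a a + - 1 * u b a)) < 0"
      using ub assms(1) by (simp add: u mult_pos_neg)
    ultimately show "nderiv 1 h a = 0" "nderiv 2 h a < 0" by auto
    have "nderiv 2 h b = (real n)\<^sup>2 * (u a b * (u a b + - 1 * u b b))" "nderiv 1 h b = 0"
      using nderiv_product_at_double_zero[OF smooth rest u double_zero(1), of b a]
      unfolding double_zero(2) h_b by auto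
    moreover have "(real n)\<^sup>2 * (u a b * (u a b + - 1 * u b b)) > 0"
      using ub assms(1) by (simp add: u)
    ultimately show "nderiv 1 h b = 0" "nderiv 2 h b > 0" by auto
  qed
qed

text \<open>The bump needs centres that differ modulo the period. A maximum and a minimum with
  different values do so by periodicity; the constant case is treated apart.\<close>

lemma support_space_extrema:
  assumes "n > 0" "g \<in> support_space n"
  obtains a b :: real where "\<And>x. g x \<le> g a" "\<And>x. g b \<le> g x" "cos (real n * (a - b)) \<noteq> 1"
proof -
  have g: "C_infinity g" "periodic (2 * pi / n) g"
    using assms(2) by (auto simp: support_space_def)
  have P: "2 * pi / n > 0" using assms(1) by simp
  have cont: "isCont g x" for x using C_infinity_isCont[OF g(1), where k = 0] by simp
  obtain a b where ab: "\<And>x. g x \<le> g a" "\<And>x. g b \<le> g x"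
    using periodic_extrema[OF g(2) P cont] by blast
  show ?thesis
  proof (cases "g a = g b")
    case True
    then have const: "g x = g y" for x y
      using True ab(1)[of x] ab(1)[of y] ab(2)[of x] ab(2)[of y] by linarith
    \<comment> \<open>For constant g every point is extremal, so two points half a period apart can
      be chosen.\<close>
    have "cos (real n * (0 - pi / n)) \<noteq> 1" using assms(1) by simp
    then show ?thesis using that[of 0 "pi / n"] const by (metis order_refl)
  next
    case False
    have "cos (real n * (a - b)) \<noteq> 1"
    proof
      assume "cos (real n * (a - b)) = 1"
      then obtain j :: int where "real n * (a - b) = of_int j * 2 * pi"
        by (auto simp: cos_one_2pi_int)
      then have "a = b + of_int j * (2 * pi / n)" using assms(1) by (simp add: field_simps)
      then show False using False periodic_int[OF g(2), of b j] by simp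
    qed
    then show ?thesis using that ab by blast
  qed
qed

text \<open>At the global extrema g'' already has the right weak sign, and the bump adds a strict
  one there while leaving both points critical; so an arbitrarily small multiple of it
  suffices.\<close>

lemma support_space_perturbation:
  assumes "n > 0" "g \<in> support_space n" "r > 0"
  obtains f where "f \<in> support_space n" "C2_dist n g f < r"
    "\<exists>x. nderiv 1 f x = 0 \<and> nderiv 2 f x > 0" "\<exists>x. nderiv 1 f x = 0 \<and> nderiv 2 f x < 0"
proof -
  have g: "C_infinity g" "periodic (2 * pi / n) g" "\<And>x. g x > 0" "\<And>x. g x + nderiv 2 g x > 0"
    using assms(2) by (auto simp: support_space_def)
  have P: "2 * pi / n > 0" using assms(1) by simp
  obtain a b where ab: "\<And>x. g x \<le> g a" "\<And>x. g b \<le> g x" "cos (real n * (a - b)) \<noteq> 1"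
    using support_space_extrema[OF assms(1,2)] by metis
  obtain h :: "real \<Rightarrow> real" where h: "C_infinity h" "periodic (2 * pi / n) h"
    "nderiv 1 h a = 0" "nderiv 2 h a < 0" "nderiv 1 h b = 0" "nderiv 2 h b > 0"
    by (rule periodic_bump[OF assms(1) ab(3)])
  have "periodic (2 * pi / n) (\<lambda>x. g x + nderiv 2 g x)"
    using g(2) periodic_nderiv[OF g(1,2), of 2] by (simp add: periodic_def)
  moreover have "isCont (\<lambda>x. g x + nderiv 2 g x) x" for x
    using C_infinity_isCont[OF g(1), where k = 0] C_infinity_isCont[OF g(1), where k = 2]
    by (intro isCont_add) simp_all
  ultimately obtain c where c: "\<And>x. g c + nderiv 2 g c \<le> g x + nderiv 2 g x"
    using periodic_extrema(2)[OF _ P] by blast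
  have "\<exists>B. \<forall>x. \<bar>nderiv k h x\<bar> \<le> B" for k
    using periodic_smooth_bounded[OF h(1,2) P] by blast
  then obtain B where B: "\<And>k x. \<bar>nderiv k h x\<bar> \<le> B k" by metis
  \<comment> \<open>The summand 1 makes M positive, for the division below.\<close>
  define M where "M = 1 + \<bar>B 0\<bar> + \<bar>B 1\<bar> + \<bar>B 2\<bar>"
  have M: "\<bar>nderiv k h x\<bar> \<le> M" if "k \<le> 2" for k x
  proof -
    have "k = 0 \<or> k = 1 \<or> k = 2" using that by linarith
    then show ?thesis using B[of k x] by (auto simp: M_def)
  qed
  have "M > 0" by (simp add: M_def)
  \<comment> \<open>The smallest of three margins: the minimum of g, the minimum of g + g'', and the
    allowed distance.\<close>
  define \<mu> where "\<mu> = min (g b) (min (g c + nderiv 2 g c) r)"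
  have \<mu>: "\<mu> > 0" using g assms(3) by (simp add: \<mu>_def)
  \<comment> \<open>With the factor 3, g + g'' loses at most 2 \<mu> / 3 through the two perturbed
    terms and stays positive.\<close>
  define \<epsilon> where "\<epsilon> = \<mu> / (3 * M)"
  have \<epsilon>: "\<epsilon> > 0" using \<mu> \<open>M > 0\<close> by (simp add: \<epsilon>_def)
  have small: "\<bar>\<epsilon> * nderiv k h x\<bar> \<le> \<mu> / 3" if "k \<le> 2" for k x
  proof -
    have "\<bar>\<epsilon> * nderiv k h x\<bar> \<le> \<epsilon> * M" using M[OF that] \<epsilon> by (simp add: abs_mult)
    also have "\<dots> = \<mu> / 3" using \<open>M > 0\<close> by (simp add: \<epsilon>_def)
    finally show ?thesis .
  qed
  define f where "f x = g x + \<epsilon> * h x" for x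
  have smooth: "C_infinity (\<lambda>x. \<epsilon> * h x)"
    by (intro C_infinity_mult C_infinity_const h)
  have nf: "nderiv k f = (\<lambda>x. nderiv k g x + \<epsilon> * nderiv k h x)" for k
    unfolding f_def nderiv_add[OF g(1) smooth] nderiv_cmult[OF h(1)] ..
  have "f \<in> support_space n"
    unfolding support_space_def
  proof (intro CollectI conjI allI)
    show "C_infinity f" unfolding f_def by (intro C_infinity_add g smooth)
    show "periodic (2 * pi / n) f" using g(2) h(2) by (simp add: periodic_def f_def)
    show "f x > 0" for x
      using small[of 0 x] ab(2)[of x] \<mu> by (auto simp: f_def \<mu>_def)
    show "f x + nderiv 2 f x > 0" for x
      using small[of 0 x] small[of 2 x] c[of x] \<mu> unfolding nf
      by (simp add: f_def \<mu>_def) linarith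
  qed
  moreover have "C2_dist n g f < r"
  proof -
    have "C2_dist n g f \<le> \<mu> / 3"
      using small by (intro C2_dist_least assms(1,2) \<open>f \<in> support_space n\<close>) (simp add: nf)
    also have "\<dots> < \<mu>" using \<mu> by simp
    also have "\<dots> \<le> r" by (simp add: \<mu>_def)
    finally show ?thesis .
  qed
  moreover have "nderiv 1 f b = 0" "nderiv 1 f a = 0"
    using C_infinity_second_derivative_at_maximum(1)[OF g(1) ab(1)]
      C_infinity_second_derivative_at_minimum(1)[OF g(1) ab(2)] h(3,5)
    by (simp_all add: nf)
  moreover have "nderiv 2 f b > 0" "nderiv 2 f a < 0"
    using C_infinity_second_derivative_at_maximum(2)[OF g(1) ab(1)]
      C_infinity_second_derivative_at_minimum(2)[OF g(1) ab(2)]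
      mult_pos_pos[OF \<epsilon> h(6)] mult_pos_neg[OF \<epsilon> h(4)]
    unfolding nf by linarith+
  ultimately show ?thesis using that by blast
qed

section \<open>Openness and density among support functions, and transfer to ovals\<close>

definition elliptic_hyperbolic_supports :: "nat \<Rightarrow> (real \<Rightarrow> real) set" where
  "elliptic_hyperbolic_supports n = {g \<in> support_space n.
     (\<exists>x. nderiv 1 g x = 0 \<and> nderiv 2 g x > 0) \<and> (\<exists>x. nderiv 1 g x = 0 \<and> nderiv 2 g x < 0)}"

text \<open>Each of the two nondegenerate critical points survives within a radius of its own, and
  the smaller radius serves both.\<close>

lemma openin_elliptic_hyperbolic_supports:
  assumes "n > 0"
  shows "openin (support_topology n) (elliptic_hyperbolic_supports n)"
proof -
  interpret Metric_space "support_space n" "C2_dist n"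
    by (rule Metric_space_C2_dist[OF assms])
  have "\<exists>r>0. mball g r \<subseteq> elliptic_hyperbolic_supports n" if g_in: "g \<in> elliptic_hyperbolic_supports n" for g
  proof -
    have g: "g \<in> support_space n" "C_infinity g"
      using g_in by (simp_all add: elliptic_hyperbolic_supports_def support_space_def)
    obtain a b where ab: "nderiv 1 g a = 0" "nderiv 2 g a > 0" "nderiv 1 g b = 0" "nderiv 2 g b < 0"
      using g_in unfolding elliptic_hyperbolic_supports_def by blast
    obtain r where r: "r > 0"
      "\<forall>f. C_infinity f \<and> (\<forall>k\<le>2. \<forall>x. \<bar>nderiv k g x - nderiv k f x\<bar> < r) \<longrightarrow>
        (\<exists>x. nderiv 1 f x = 0 \<and> nderiv 2 f x > 0)"
      using nondegenerate_minimum_stable[OF g(2) ab(1,2)] by blast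
    obtain s where s: "s > 0"
      "\<forall>f. C_infinity f \<and> (\<forall>k\<le>2. \<forall>x. \<bar>nderiv k g x - nderiv k f x\<bar> < s) \<longrightarrow>
        (\<exists>x. nderiv 1 f x = 0 \<and> nderiv 2 f x < 0)"
      using nondegenerate_maximum_stable[OF g(2) ab(3,4)] by blast
    have "f \<in> elliptic_hyperbolic_supports n" if "f \<in> mball g (min r s)" for f
    proof -
      have f: "f \<in> support_space n" "C2_dist n g f < min r s"
        using that by simp_all
      then have smooth: "C_infinity f" by (simp add: support_space_def)
      have "\<bar>nderiv k g x - nderiv k f x\<bar> < min r s" if "k \<le> 2" for k x
        using C2_dist_upper[OF g(1) f(1) assms that] f(2) by (rule le_less_trans)
      then have "\<forall>k\<le>2. \<forall>x. \<bar>nderiv k g x - nderiv k f x\<bar> < r"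
        "\<forall>k\<le>2. \<forall>x. \<bar>nderiv k g x - nderiv k f x\<bar> < s" by auto
      then show ?thesis
        using r(2) s(2) f(1) smooth unfolding elliptic_hyperbolic_supports_def by blast
    qed
    then show ?thesis using r(1) s(1) by (intro exI[of _ "min r s"]) auto
  qed
  then show ?thesis
    unfolding support_topology_def openin_mtopology by (auto simp: elliptic_hyperbolic_supports_def)
qed

lemma support_topology_dense:
  assumes "n > 0" "openin (support_topology n) U" "g \<in> U"
  obtains f where "f \<in> U" "f \<in> elliptic_hyperbolic_supports n"
proof -
  interpret Metric_space "support_space n" "C2_dist n"
    by (rule Metric_space_C2_dist[OF assms(1)])
  obtain r where r: "r > 0" "mball g r \<subseteq> U" and g: "g \<in> support_space n"
    using assms(2,3) unfolding support_topology_def openin_mtopology by blast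
  obtain f where f: "f \<in> support_space n" "C2_dist n g f < r"
    "\<exists>x. nderiv 1 f x = 0 \<and> nderiv 2 f x > 0" "\<exists>x. nderiv 1 f x = 0 \<and> nderiv 2 f x < 0"
    by (rule support_space_perturbation[OF assms(1) g r(1)])
  then have "f \<in> mball g r" using g by (intro in_mball[THEN iffD2] conjI)
  then have "f \<in> U" using f(1,2) r(2) by blast
  moreover have "f \<in> elliptic_hyperbolic_supports n"
    using f unfolding elliptic_hyperbolic_supports_def by blast
  ultimately show ?thesis by (rule that)
qed

text \<open>Open sets of the pullback topology are traces of preimages under
  \<open>support_fun\<close>, so openness transfers at once. For density, a good support function
  found in U must come from an oval, as \<open>support_space_realization\<close> guarantees.\<close>

theorem proposition4p2:
  fixes n :: nat
  assumes "n \<ge> 2"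
  shows "openin (oval_topology n) (elliptic_hyperbolic_ovals n) \<and>
         (oval_topology n) closure_of (elliptic_hyperbolic_ovals n) = sym_ovals n"
proof
  have "n > 0" using assms by simp
  let ?V = "elliptic_hyperbolic_supports n"
  have EH: "elliptic_hyperbolic_ovals n = support_fun -` ?V \<inter> sym_ovals n"
    using elliptic_hyperbolic_ovals_iff[OF assms] support_fun_in_support_space[OF _ assms]
    by (auto simp: elliptic_hyperbolic_supports_def)
  show "openin (oval_topology n) (elliptic_hyperbolic_ovals n)"
    unfolding oval_topology_def openin_pullback_topology EH
    using openin_elliptic_hyperbolic_supports[OF \<open>n > 0\<close>] by blast
  interpret Metric_space "support_space n" "C2_dist n"
    by (rule Metric_space_C2_dist[OF \<open>n > 0\<close>])
  have top: "topspace (oval_topology n) = sym_ovals n"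
    using support_fun_in_support_space[OF _ assms]
    by (auto simp: oval_topology_def topspace_pullback_topology support_topology_def)
  show "(oval_topology n) closure_of (elliptic_hyperbolic_ovals n) = sym_ovals n"
  proof
    show "(oval_topology n) closure_of (elliptic_hyperbolic_ovals n) \<subseteq> sym_ovals n"
      using closure_of_subset_topspace[of "oval_topology n"] top by simp
    show "sym_ovals n \<subseteq> (oval_topology n) closure_of (elliptic_hyperbolic_ovals n)"
    proof
      fix \<Gamma> assume \<Gamma>: "\<Gamma> \<in> sym_ovals n"
      have "\<exists>\<Delta>. \<Delta> \<in> elliptic_hyperbolic_ovals n \<and> \<Delta> \<in> W"
        if W: "\<Gamma> \<in> W" "openin (oval_topology n) W" for W
      proof -
        obtain U where U: "openin (support_topology n) U" "W = support_fun -` U \<inter> sym_ovals n"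
          using W(2) unfolding oval_topology_def openin_pullback_topology by blast
        have "support_fun \<Gamma> \<in> U" using W(1) U(2) by blast
        then obtain f where f: "f \<in> U" "f \<in> ?V"
          by (rule support_topology_dense[OF \<open>n > 0\<close> U(1)])
        then have "f \<in> support_space n" by (simp add: elliptic_hyperbolic_supports_def)
        then obtain \<Delta> where "\<Delta> \<in> sym_ovals n" "support_fun \<Delta> = f"
          by (rule support_space_realization[OF assms])
        then show ?thesis using f unfolding EH U(2) by blast
      qed
      then show "\<Gamma> \<in> (oval_topology n) closure_of (elliptic_hyperbolic_ovals n)"
        using \<Gamma> top by (auto simp: in_closure_of)
    qed
  qed
qed

end
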